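(* Let $r\ge0$, $q=r+1$, $p\ge1$, $d_h,\rho_h>0$ ($1\le h\le r$), $\widehat a_*\in\mathbb R$, and $\xi_1,\dots,\xi_p\in\mathbb R$ with $\xi_i+\rho_h>0$ for all $i,h$. With the transformed rows $V_{j,\tau}$ of the Laguerre system of the second kind and the Hermite rows $U_j^{\mathrm H}$ defined in the context, the following hold. (1) For each $j\in\{1,\dots,q\}$ the rows converge locally uniformly on $\mathbb R$, and for each $i,j$, $$V_{j,\tau}(t)\xrightarrow[\tau\to+\infty]{}U_j^{\mathrm H}(t),\qquad\int_{\mathbb R}\mathrm e^{\xi_it}|V_{j,\tau}(t)-U_j^{\mathrm H}(t)|\,\mathrm dt\xrightarrow[\tau\to+\infty]{}0.$$ (2) For every fixed $v\in\mathbb N_0$ and all $i,j$, $$\int_{\mathbb R}t^v\mathrm e^{\xi_it}\bigl(V_{j,\tau}(t)-U_j^{\mathrm H}(t)\bigr)\,\mathrm dt=\mathrm O(\tau^{-1/2}),\qquad\tau\to+\infty.$$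
   Context: $\kappa_{\rho,d}(u)=\frac{\rho^d}{\Gamma(d)}u^{d-1}\mathrm e^{-\rho u}\mathbf 1_{(0,\infty)}(u)$ for $\rho,d>0$; $(K_{\rho,d}f)(t)=\int_0^\infty\kappa_{\rho,d}(u)f(t+u)\,\mathrm du$; $\phi_a(t)=\pi^{-1/2}\mathrm e^{-(t-a)^2}$; $F=K_{\rho_1,d_1}\cdots K_{\rho_r,d_r}\phi_{\widehat a_*}$; $U_h^{\mathrm H}=K_{\rho_h,1}F$ ($1\le h\le r$), $U_q^{\mathrm H}=F$. For $\tau>0$: $h_\tau=\sqrt{2\tau}$, $\boldsymbol d_\tau=(d_1,\dots,d_r,\tau)$, $\boldsymbol\varrho_\tau=(\rho_1/h_\tau,\dots,\rho_r/h_\tau,1)$, and for $1\le j\le q$ $$f_{j,\tau}=\kappa_{\varrho_{1,\tau},d_{1,\tau}+\delta_{1,j}}*_+\cdots*_+\kappa_{\varrho_{q,\tau},d_{q,\tau}+\delta_{q,j}},\qquad(f*_+g)(y)=\int_0^yf(u)g(y-u)\,\mathrm du,$$ (these are the rows of the Laguerre system of the second kind with shapes $\boldsymbol d_\tau$ and rates $\boldsymbol\varrho_\tau$, normalized to integral one). The transformed rows are $V_{j,\tau}(t)=h_\tau f_{j,\tau}(y_\tau(t))$ with $y_\tau(t)=\tau+h_\tau(\widehat a_*-t)$; $V_{j,\tau}$ vanishes for $t\ge\widehat a_*+\tau/h_\tau$. The integrals against $\mathrm e^{\xi_it}$ are finite for all sufficiently large $\tau$. *)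

theory Defs
  imports "HOL-Analysis.Analysis" "HOL-Library.Landau_Symbols"
begin

definition gkernel :: "real \<Rightarrow> real \<Rightarrow> real \<Rightarrow> real" where
  "gkernel \<rho> d u = (if u > 0 then \<rho> powr d / Gamma d * u powr (d - 1) * exp (- \<rho> * u) else 0)"

definition Kop :: "real \<Rightarrow> real \<Rightarrow> (real \<Rightarrow> real) \<Rightarrow> real \<Rightarrow> real" where
  "Kop \<rho> d f t = (LBINT u:{0<..}. gkernel \<rho> d u * f (t + u))"

definition gauss :: "real \<Rightarrow> real \<Rightarrow> real" where
  "gauss a t = exp (- (t - a)\<^sup>2) / sqrt pi"

text \<open>Parameter families are functions on \<open>nat\<close> of which only the indices \<open>1, \<dots>, r\<close>
  (for rows: \<open>1, \<dots>, r + 1\<close>) matter.\<close>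

definition hermF :: "nat \<Rightarrow> (nat \<Rightarrow> real) \<Rightarrow> (nat \<Rightarrow> real) \<Rightarrow> real \<Rightarrow> real \<Rightarrow> real" where
  "hermF r \<rho> d a = foldr (\<lambda>h. Kop (\<rho> h) (d h)) [1..<r + 1] (gauss a)"

definition hermU :: "nat \<Rightarrow> (nat \<Rightarrow> real) \<Rightarrow> (nat \<Rightarrow> real) \<Rightarrow> real \<Rightarrow> nat \<Rightarrow> real \<Rightarrow> real" where
  "hermU r \<rho> d a j = (if j = r + 1 then hermF r \<rho> d a else Kop (\<rho> j) 1 (hermF r \<rho> d a))"

definition pconv :: "(real \<Rightarrow> real) \<Rightarrow> (real \<Rightarrow> real) \<Rightarrow> real \<Rightarrow> real" where
  "pconv f g y = (LBINT u=0..y. f u * g (y - u))"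

definition hscale :: "real \<Rightarrow> real" where
  "hscale \<tau> = sqrt (2 * \<tau>)"

definition shape :: "nat \<Rightarrow> (nat \<Rightarrow> real) \<Rightarrow> real \<Rightarrow> nat \<Rightarrow> real" where
  "shape r d \<tau> l = (if l = r + 1 then \<tau> else d l)"

definition rate :: "nat \<Rightarrow> (nat \<Rightarrow> real) \<Rightarrow> real \<Rightarrow> nat \<Rightarrow> real" where
  "rate r \<rho> \<tau> l = (if l = r + 1 then 1 else \<rho> l / hscale \<tau>)"

definition lagFactor ::
    "nat \<Rightarrow> (nat \<Rightarrow> real) \<Rightarrow> (nat \<Rightarrow> real) \<Rightarrow> real \<Rightarrow> nat \<Rightarrow> nat \<Rightarrow> real \<Rightarrow> real" where
  "lagFactor r \<rho> d \<tau> j l = gkernel (rate r \<rho> \<tau> l) (shape r d \<tau> l + of_bool (l = j))"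

text \<open>\<open>lagRow r \<rho> d j \<tau>\<close> is row \<open>j\<close> of the Laguerre system of the second kind with shapes
  \<open>shape r d \<tau>\<close> and rates \<open>rate r \<rho> \<tau>\<close>, normalized to integral one.
  The iterated convolution is bracketed to the right; on functions supported in
  \<open>(0, \<infinity>)\<close> the operation is associative.\<close>

definition lagRow ::
    "nat \<Rightarrow> (nat \<Rightarrow> real) \<Rightarrow> (nat \<Rightarrow> real) \<Rightarrow> nat \<Rightarrow> real \<Rightarrow> real \<Rightarrow> real" where
  "lagRow r \<rho> d j \<tau> =
     foldr (\<lambda>l. pconv (lagFactor r \<rho> d \<tau> j l)) [1..<r + 1] (lagFactor r \<rho> d \<tau> j (r + 1))"

definition lagV ::
    "nat \<Rightarrow> (nat \<Rightarrow> real) \<Rightarrow> (nat \<Rightarrow> real) \<Rightarrow> real \<Rightarrow> nat \<Rightarrow> real \<Rightarrow> real \<Rightarrow> real" where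
  "lagV r \<rho> d a j \<tau> t = hscale \<tau> * lagRow r \<rho> d j \<tau> (\<tau> + hscale \<tau> * (a - t))"

end

theory Submission
  imports Defs "HOL-Probability.Distributions"
begin

text \<open>
  Substituting \<open>u \<mapsto> hscale \<tau> * u\<close> in the convolutions shows that the transformed row is
  \<open>K\<^sub>1 \<dots> K\<^sub>r G\<close>, where \<open>K\<^sub>h\<close> are the same operators that build the Hermite row from the Gaussian
  (for \<open>j \<le> r\<close> the extra \<open>Kop (\<rho> j) 1\<close> is absorbed by commutativity and the semigroup law) and
  \<open>G\<close> is the rescaled Gamma density alone. Elementary bounds for \<open>ln (1 - z)\<close> give
  \<open>\<bar>G t - gauss a t\<bar> \<le> C * \<tau> powr (- 1 / 2) * exp (- M * \<bar>t\<bar>)\<close> for every \<open>M\<close>; the normalizing constant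
  needs no Stirling formula, because \<open>G\<close> and the Gaussian both have integral one. Since \<open>Kop \<rho> d\<close>
  preserves bounds by \<open>exp (\<beta> * t)\<close> with \<open>\<beta> < \<rho>\<close>, using \<open>\<beta> = - \<xi> \<plusminus> \<delta>\<close> bounds the difference of the rows
  by a multiple of \<open>\<tau> powr (- 1 / 2) * exp (- \<xi> * t - \<delta> * \<bar>t\<bar>)\<close>, from which all claims follow.
\<close>

subsection \<open>Exponential bounds for the operators\<close>

lemma gkernel_nonneg: "d > 0 \<Longrightarrow> gkernel \<rho> d u \<ge> 0"
  by (auto simp: gkernel_def intro!: mult_nonneg_nonneg divide_nonneg_pos Gamma_real_pos)

lemma borel_measurable_gkernel [measurable]: "gkernel \<rho> d \<in> borel_measurable borel"
  unfolding gkernel_def[abs_def] by measurable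

lemma has_bochner_integral_gkernel_1:
  assumes d: "d > 0"
  shows "has_bochner_integral lborel (gkernel 1 d) 1"
proof (rule has_bochner_integral_nn_integral)
  have G: "Gamma d > 0" using d by (rule Gamma_real_pos)
  have "(\<integral>\<^sup>+x. ennreal (gkernel 1 d x) \<partial>lborel) =
      (\<integral>\<^sup>+x. ennreal (1 / Gamma d) * ennreal (indicator {0..} x * x powr (d - 1) / exp x) \<partial>lborel)"
    using G by (intro nn_integral_cong)
      (auto simp: gkernel_def ennreal_mult'[symmetric] indicator_def exp_minus field_simps)
  also have "\<dots> = ennreal (1 / Gamma d) * ennreal (Gamma d)"
    using d by (subst nn_integral_cmult) (auto simp: Gamma_conv_nn_integral_real)
  also have "\<dots> = ennreal 1"
    using G by (simp add: ennreal_mult'[symmetric] flip: ennreal_1)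
  finally show "(\<integral>\<^sup>+x. ennreal (gkernel 1 d x) \<partial>lborel) = ennreal 1" .
qed (use d in \<open>auto simp: gkernel_nonneg\<close>)

text \<open>The factor \<open>c\<close> is the Jacobian of \<open>u \<mapsto> c * u\<close>. This
  identity later turns the rates \<open>\<rho> l / hscale \<tau>\<close> of the Laguerre rows into
  the fixed rates \<open>\<rho> l\<close> of the operators.\<close>

lemma gkernel_scale:
  assumes "c > 0" "\<rho> > 0"
  shows "c * gkernel (\<rho> / c) d (c * u) = gkernel \<rho> d u"
proof (cases "u > 0")
  case True
  have 1: "c * ((\<rho> / c) powr d * (c * u) powr (d - 1)) = \<rho> powr d * u powr (d - 1)"
  proof -
    have "c * c powr (d - 1) = c powr d"
      using assms by (simp add: powr_diff)
    then show ?thesis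
      using assms True by (simp add: powr_divide powr_mult field_simps)
  qed
  have "c * gkernel (\<rho> / c) d (c * u)
      = c * ((\<rho> / c) powr d * (c * u) powr (d - 1)) / Gamma d * exp (- \<rho> * u)"
    using assms True by (simp add: gkernel_def)
  then show ?thesis unfolding 1 using True by (simp add: gkernel_def)
next
  case False
  then show ?thesis using assms by (simp add: gkernel_def zero_less_mult_iff)
qed

lemma has_bochner_integral_gkernel:
  assumes "\<rho> > 0" and d: "d > 0"
  shows "has_bochner_integral lborel (gkernel \<rho> d) 1"
proof -
  \<comment> \<open>Dilating by \<open>\<rho>\<close> itself, that is \<open>gkernel_scale\<close>
    with \<open>c = \<rho>\<close>, reduces the claim to rate one.\<close>
  have "has_bochner_integral lborel (\<lambda>u. gkernel 1 d (0 + \<rho> * u)) (1 /\<^sub>R \<bar>\<rho>\<bar>)"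
    using lborel_has_bochner_integral_real_affine_iff[of \<rho> "gkernel 1 d" 1 0]
      has_bochner_integral_gkernel_1[OF d] assms by simp
  then have "has_bochner_integral lborel (\<lambda>u. \<rho> * gkernel 1 d (0 + \<rho> * u)) (\<rho> * (1 /\<^sub>R \<bar>\<rho>\<bar>))"
    by (intro has_bochner_integral_mult_right)
  then show ?thesis
    using assms gkernel_scale[of \<rho> \<rho> d] by simp
qed

text \<open>Tilting by an exponential only shifts the rate. The constant is the quotient of the two
  normalizations, so it is the moment generating function of the Gamma law at
  \<open>\<beta>\<close>.\<close>

lemma gkernel_exp:
  assumes "\<beta> < \<rho>" "\<rho> > 0"
  shows "gkernel \<rho> d u * exp (\<beta> * u) = (\<rho> / (\<rho> - \<beta>)) powr d * gkernel (\<rho> - \<beta>) d u"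
proof -
  have "exp (- \<rho> * u) * exp (\<beta> * u) = exp (- (\<rho> - \<beta>) * u)"
    by (simp add: exp_add[symmetric] algebra_simps)
  then show ?thesis
    using assms by (auto simp: gkernel_def powr_divide field_simps)
qed

lemma has_bochner_integral_gkernel_exp:
  assumes "\<beta> < \<rho>" "\<rho> > 0" "d > 0"
  shows "has_bochner_integral lborel (\<lambda>u. gkernel \<rho> d u * exp (\<beta> * u)) ((\<rho> / (\<rho> - \<beta>)) powr d)"
  using has_bochner_integral_mult_right[OF has_bochner_integral_gkernel[of "\<rho> - \<beta>" d],
      of "(\<rho> / (\<rho> - \<beta>)) powr d"] assms
  by (simp add: gkernel_exp)

section \<open>The operators on functions of exponential growth\<close>

lemma Kop_eq: "Kop \<rho> d f t = (LBINT u. gkernel \<rho> d u * f (t + u))"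
  unfolding Kop_def set_lebesgue_integral_def
  by (intro Bochner_Integration.integral_cong) (auto simp: gkernel_def indicator_def)

text \<open>A one-sided exponential is used because \<open>Kop \<rho> d\<close> maps it to a
  multiple of itself whenever \<open>\<beta> < \<rho>\<close>. The value \<open>\<beta> = 0\<close>
  describes bounded functions, for which the algebraic laws below are proved.\<close>

definition exp_bounded :: "real \<Rightarrow> (real \<Rightarrow> real) \<Rightarrow> bool" where
  "exp_bounded \<beta> f \<longleftrightarrow> f \<in> borel_measurable borel \<and> (\<exists>A. \<forall>t. \<bar>f t\<bar> \<le> A * exp (\<beta> * t))"

lemma exp_bounded_measurable: "exp_bounded \<beta> f \<Longrightarrow> f \<in> borel_measurable borel"
  by (simp add: exp_bounded_def)

lemma Kop_integrable:
  assumes f: "exp_bounded \<beta> f" and p: "\<beta> < \<rho>" "\<rho> > 0" "d > 0"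
  shows "integrable lborel (\<lambda>u. gkernel \<rho> d u * f (t + u))"
proof -
  obtain A where A: "\<And>t. \<bar>f t\<bar> \<le> A * exp (\<beta> * t)" using f by (auto simp: exp_bounded_def)
  note [measurable] = exp_bounded_measurable[OF f]
  show ?thesis
  proof (rule Bochner_Integration.integrable_bound)
    show "integrable lborel (\<lambda>u. A * exp (\<beta> * t) * (gkernel \<rho> d u * exp (\<beta> * u)))"
      using has_bochner_integral_gkernel_exp[OF p] by (auto simp: has_bochner_integral_iff)
    have "\<bar>gkernel \<rho> d u * f (t + u)\<bar> \<le> A * exp (\<beta> * t) * (gkernel \<rho> d u * exp (\<beta> * u))" for u
    proof -
      have "gkernel \<rho> d u * \<bar>f (t + u)\<bar> \<le> gkernel \<rho> d u * (A * exp (\<beta> * (t + u)))"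
        using A p by (intro mult_left_mono gkernel_nonneg)
      then show ?thesis
        using p by (simp add: abs_mult gkernel_nonneg exp_add algebra_simps)
    qed
    then show "AE u in lborel. norm (gkernel \<rho> d u * f (t + u))
        \<le> norm (A * exp (\<beta> * t) * (gkernel \<rho> d u * exp (\<beta> * u)))"
      by (intro AE_I2) (smt (verit) real_norm_def)
  qed measurable
qed

text \<open>The kernel is nonnegative and \<open>exp (\<beta> * t)\<close> is an eigenfunction of
  \<open>Kop \<rho> d\<close> with eigenvalue
  \<open>(\<rho> / (\<rho> - \<beta>)) powr d\<close>.\<close>

lemma Kop_bound:
  assumes f: "f \<in> borel_measurable borel" and A: "\<And>t. \<bar>f t\<bar> \<le> A * exp (\<beta> * t)"
    and p: "\<beta> < \<rho>" "\<rho> > 0" "d > 0"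
  shows "\<bar>Kop \<rho> d f t\<bar> \<le> (\<rho> / (\<rho> - \<beta>)) powr d * A * exp (\<beta> * t)"
proof -
  have eb: "exp_bounded \<beta> f" using f A by (auto simp: exp_bounded_def)
  have I: "integrable lborel (\<lambda>u. A * exp (\<beta> * t) * (gkernel \<rho> d u * exp (\<beta> * u)))"
    using has_bochner_integral_gkernel_exp[OF p] by (auto simp: has_bochner_integral_iff)
  have "\<bar>Kop \<rho> d f t\<bar> \<le> (LBINT u. \<bar>gkernel \<rho> d u * f (t + u)\<bar>)"
    unfolding Kop_eq using integral_norm_bound[of lborel "\<lambda>u. gkernel \<rho> d u * f (t + u)"] by simp
  also have "\<dots> \<le> (LBINT u. A * exp (\<beta> * t) * (gkernel \<rho> d u * exp (\<beta> * u)))"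
  proof (rule integral_mono)
    show "integrable lborel (\<lambda>u. \<bar>gkernel \<rho> d u * f (t + u)\<bar>)"
      using Kop_integrable[OF eb p] by (rule integrable_abs)
    fix u
    have "gkernel \<rho> d u * \<bar>f (t + u)\<bar> \<le> gkernel \<rho> d u * (A * exp (\<beta> * (t + u)))"
      using A p by (intro mult_left_mono gkernel_nonneg)
    then show "\<bar>gkernel \<rho> d u * f (t + u)\<bar> \<le> A * exp (\<beta> * t) * (gkernel \<rho> d u * exp (\<beta> * u))"
      using p by (simp add: abs_mult gkernel_nonneg exp_add algebra_simps)
  qed (rule I)
  also have "\<dots> = A * exp (\<beta> * t) * (\<rho> / (\<rho> - \<beta>)) powr d"
    using has_bochner_integral_gkernel_exp[OF p] by (simp add: has_bochner_integral_iff)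
  finally show ?thesis by (simp add: mult_ac)
qed

lemma borel_measurable_Kop [measurable]:
  assumes [measurable]: "f \<in> borel_measurable borel"
  shows "Kop \<rho> d f \<in> borel_measurable borel"
  unfolding Kop_eq[abs_def] by measurable

lemma exp_bounded_Kop:
  assumes f: "exp_bounded \<beta> f" and p: "\<beta> < \<rho>" "\<rho> > 0" "d > 0"
  shows "exp_bounded \<beta> (Kop \<rho> d f)"
proof -
  obtain A where A: "\<And>t. \<bar>f t\<bar> \<le> A * exp (\<beta> * t)" using f by (auto simp: exp_bounded_def)
  note [measurable] = exp_bounded_measurable[OF f]
  show ?thesis
    unfolding exp_bounded_def using Kop_bound[of f A \<beta>, OF _ A p] by auto
qed

lemma Kop_diff:
  assumes "exp_bounded \<beta> f" "exp_bounded \<beta> g" "\<beta> < \<rho>" "\<rho> > 0" "d > 0"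
  shows "Kop \<rho> d f t - Kop \<rho> d g t = Kop \<rho> d (\<lambda>t. f t - g t) t"
  unfolding Kop_eq right_diff_distrib
  by (intro Bochner_Integration.integral_diff[symmetric] Kop_integrable[OF assms(1,3-5)]
      Kop_integrable[OF assms(2,3-5)])

lemma exp_bounded_foldr_Kop:
  assumes "exp_bounded \<beta> f" "\<And>l. l \<in> set ls \<Longrightarrow> \<beta> < \<rho> l \<and> \<rho> l > 0 \<and> d l > 0"
  shows "exp_bounded \<beta> (foldr (\<lambda>l. Kop (\<rho> l) (d l)) ls f)"
  using assms by (induction ls) (auto intro!: exp_bounded_Kop)

text \<open>Linearity reduces each layer to \<open>Kop_bound\<close>, and the eigenvalues multiply.
  The product does not depend on \<open>f\<close> and \<open>g\<close>, so a rate of convergence of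
  the innermost functions passes unchanged to the rows.\<close>

lemma foldr_Kop_diff_bound:
  fixes \<rho> d :: "'a \<Rightarrow> real"
  assumes f: "exp_bounded \<beta> f" and g: "exp_bounded \<beta> g"
    and A: "\<And>t. \<bar>f t - g t\<bar> \<le> A * exp (\<beta> * t)"
    and p: "\<And>l. l \<in> set ls \<Longrightarrow> \<beta> < \<rho> l \<and> \<rho> l > 0 \<and> d l > 0"
  shows "\<bar>foldr (\<lambda>l. Kop (\<rho> l) (d l)) ls f t - foldr (\<lambda>l. Kop (\<rho> l) (d l)) ls g t\<bar>
    \<le> (\<Prod>l\<leftarrow>ls. (\<rho> l / (\<rho> l - \<beta>)) powr d l) * A * exp (\<beta> * t)"
  using p
proof (induction ls arbitrary: t)
  case (Cons l ls)
  let ?F = "foldr (\<lambda>l. Kop (\<rho> l) (d l)) ls f" and ?G = "foldr (\<lambda>l. Kop (\<rho> l) (d l)) ls g"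
  have eb: "exp_bounded \<beta> ?F" "exp_bounded \<beta> ?G"
    using Cons.prems f g by (auto intro!: exp_bounded_foldr_Kop)
  note [measurable] = eb[THEN exp_bounded_measurable]
  have "\<bar>Kop (\<rho> l) (d l) (\<lambda>t. ?F t - ?G t) t\<bar> \<le> (\<rho> l / (\<rho> l - \<beta>)) powr d l
      * ((\<Prod>l\<leftarrow>ls. (\<rho> l / (\<rho> l - \<beta>)) powr d l) * A) * exp (\<beta> * t)"
    using Cons by (intro Kop_bound) auto
  then show ?case
    using Kop_diff[OF eb, of "\<rho> l" "d l" t] Cons.prems by (simp add: mult_ac)
qed (use A in auto)

subsection \<open>Commutation and semigroup law\<close>

text \<open>For fixed \<open>u\<close> the shift by \<open>c * u\<close> preserves Lebesgue measure,
  so the integral factorizes as for a tensor product. The case \<open>c = 0\<close> serves the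
  commutation law and \<open>c = 1\<close> the semigroup law.\<close>

lemma integrable_pair_shear:
  fixes P Q :: "real \<Rightarrow> real"
  assumes P: "integrable lborel P" and Q: "integrable lborel Q"
  shows "integrable (lborel \<Otimes>\<^sub>M lborel) (\<lambda>(u, s). P u * Q (s - c * u))"
proof (rule lborel_pair.Fubini_integrable)
  have [measurable]: "P \<in> borel_measurable borel" "Q \<in> borel_measurable borel"
    using assms by auto
  show "(\<lambda>(u, s). P u * Q (s - c * u)) \<in> borel_measurable (lborel \<Otimes>\<^sub>M lborel)"
    by measurable
  have I: "integrable lborel (\<lambda>s. Q (s - x))" for x
    using lborel_integrable_real_affine[OF Q, of 1 "-x"] by simp
  have "(LBINT s. norm (P u * Q (s - c * u))) = norm (P u) * (LBINT s. norm (Q s))" for u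
    using lborel_integral_real_affine[of 1 "\<lambda>s. norm (Q s)" "- c * u"] by (simp add: abs_mult)
  then show "integrable lborel (\<lambda>u. LBINT s. norm (case (u, s) of (u, s) \<Rightarrow> P u * Q (s - c * u)))"
    using integrable_mult_left[OF integrable_norm[OF P], of "LBINT s. norm (Q s)"] by simp
  show "AE u in lborel. integrable lborel (\<lambda>s. case (u, s) of (u, s) \<Rightarrow> P u * Q (s - c * u))"
    using I by simp
qed

lemma integrable_pair_shear_bounded:
  fixes P Q :: "real \<Rightarrow> real" and H :: "real \<times> real \<Rightarrow> real"
  assumes P: "integrable lborel P" and Q: "integrable lborel Q"
    and H: "H \<in> borel_measurable borel" "\<And>x. \<bar>H x\<bar> \<le> B"
  shows "integrable (lborel \<Otimes>\<^sub>M lborel) (\<lambda>(u, s). P u * Q (s - c * u) * H (u, s))"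
proof (rule Bochner_Integration.integrable_bound)
  have [measurable]: "P \<in> borel_measurable borel" "Q \<in> borel_measurable borel"
      "H \<in> borel_measurable (borel \<Otimes>\<^sub>M borel)"
    using assms by (auto simp: borel_prod)
  show "integrable (lborel \<Otimes>\<^sub>M lborel) (\<lambda>x. B * (case x of (u, s) \<Rightarrow> P u * Q (s - c * u)))"
    by (intro integrable_mult_right integrable_pair_shear P Q)
  show "(\<lambda>(u, s). P u * Q (s - c * u) * H (u, s)) \<in> borel_measurable (lborel \<Otimes>\<^sub>M lborel)"
    by measurable
  have "\<bar>y * H x\<bar> \<le> \<bar>B * y\<bar>" for x y
    using H(2)[of x] mult_left_mono[of "\<bar>H x\<bar>" "\<bar>B\<bar>" "\<bar>y\<bar>"] by (simp add: abs_mult mult_ac)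
  then show "AE x in lborel \<Otimes>\<^sub>M lborel. norm (case x of (u, s) \<Rightarrow> P u * Q (s - c * u) * H (u, s))
      \<le> norm (B * (case x of (u, s) \<Rightarrow> P u * Q (s - c * u)))"
    by (intro AE_I2) (auto simp: split_beta)
qed

text \<open>Fubini: the product of the two kernels is integrable on the plane, and \<open>f\<close>
  enters as a bounded factor in \<open>t + u + v\<close>.\<close>

lemma Kop_commute:
  assumes f: "exp_bounded 0 f" and p: "\<rho> > 0" "d > 0" "\<rho>' > 0" "d' > 0"
  shows "Kop \<rho> d (Kop \<rho>' d' f) = Kop \<rho>' d' (Kop \<rho> d f)"
proof
  fix t
  obtain A where A: "\<And>t. \<bar>f t\<bar> \<le> A" using f by (auto simp: exp_bounded_def)
  note [measurable] = exp_bounded_measurable[OF f]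
  have I: "integrable lborel (gkernel \<rho> d)" "integrable lborel (gkernel \<rho>' d')"
    using has_bochner_integral_gkernel p by (auto simp: has_bochner_integral_iff)
  have "integrable (lborel \<Otimes>\<^sub>M lborel)
      (\<lambda>(u, v). gkernel \<rho> d u * gkernel \<rho>' d' (v - 0 * u) * (case (u, v) of (u, v) \<Rightarrow> f (t + u + v)))"
    using A by (intro integrable_pair_shear_bounded I) (auto simp: borel_prod[symmetric])
  then have *: "integrable (lborel \<Otimes>\<^sub>M lborel)
      (\<lambda>(u, v). gkernel \<rho> d u * gkernel \<rho>' d' v * f (t + u + v))" by simp
  have "Kop \<rho> d (Kop \<rho>' d' f) t
      = (LBINT u. LBINT v. gkernel \<rho> d u * gkernel \<rho>' d' v * f (t + u + v))"
    by (simp add: Kop_eq mult.assoc)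
  also have "\<dots> = (LBINT v. LBINT u. gkernel \<rho> d u * gkernel \<rho>' d' v * f (t + u + v))"
    using lborel_pair.Fubini_integral[OF *] by simp
  also have "\<dots> = (LBINT v. gkernel \<rho>' d' v * (LBINT u. gkernel \<rho> d u * f (t + v + u)))"
    by (simp add: algebra_simps flip: integral_mult_right_zero)
  finally show "Kop \<rho> d (Kop \<rho>' d' f) t = Kop \<rho>' d' (Kop \<rho> d f) t"
    by (simp add: Kop_eq)
qed

text \<open>A kernel of shape 1 is a pure exponential, and the exponentials combine to
  \<open>exp (- \<rho> * s)\<close>. What remains is the integral of a power over an
  interval.\<close>

lemma gkernel_convolution_1:
  assumes p: "\<rho> > 0" "d > 0"
  shows "(LBINT u. gkernel \<rho> 1 u * gkernel \<rho> d (s - u)) = gkernel \<rho> (d + 1) s"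
proof -
  have G: "Gamma d > 0" "Gamma (d + 1) = d * Gamma d"
    using p by (auto intro!: Gamma_plus1 Gamma_real_pos elim!: nonpos_Ints_cases)
  define c where "c = \<rho> powr (d + 1) / Gamma d * exp (- \<rho> * s)"
  \<comment> \<open>The reflection \<open>u \<mapsto> s - u\<close> puts the power into the
    integration variable.\<close>
  have "(LBINT u. gkernel \<rho> 1 u * gkernel \<rho> d (s - u))
      = (LBINT u. gkernel \<rho> 1 (s - u) * gkernel \<rho> d u)"
    using lborel_integral_real_affine[of "-1" "\<lambda>u. gkernel \<rho> 1 u * gkernel \<rho> d (s - u)" s] by simp
  also have "\<dots> = (LBINT u. c * (indicator {0..s} u * u powr (d - 1)))"
  proof (rule integral_cong_AE)
    \<comment> \<open>The equality can fail at \<open>u = s\<close>, where the kernel is zero but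
      the closed interval still counts; hence it is shown almost everywhere.\<close>
    have eq: "gkernel \<rho> 1 (s - u) * gkernel \<rho> d u = c * (indicator {0..s} u * u powr (d - 1))"
      if "u \<noteq> s" "u \<noteq> 0" for u
    proof -
      have "exp (- \<rho> * (s - u)) * exp (- \<rho> * u) = exp (- \<rho> * s)"
        by (simp add: exp_add[symmetric] algebra_simps)
      then show ?thesis
        using that p by (auto simp: gkernel_def indicator_def c_def powr_add field_simps)
    qed
    show "AE u in lborel. gkernel \<rho> 1 (s - u) * gkernel \<rho> d u
        = c * (indicator {0..s} u * u powr (d - 1))"
      using AE_lborel_singleton[of s] AE_lborel_singleton[of 0] by eventually_elim (rule eq)
  qed auto
  also have "\<dots> = c * (LBINT u. indicator {0..s} u * u powr (d - 1))"
    by simp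
  also have "(LBINT u. indicator {0..s} u * u powr (d - 1)) = (if s > 0 then s powr d / d else 0)"
  proof (cases "s > 0")
    case True
    have "((\<lambda>u. u powr (d - 1)) has_integral s powr (d - 1 + 1) / (d - 1 + 1)) {0..s}"
      using True p by (intro has_integral_powr_from_0) auto
    then have "(\<integral>\<^sup>+u. ennreal (indicator {0..s} u * u powr (d - 1)) \<partial>lborel) = ennreal (s powr d / d)"
      by (intro nn_integral_has_integral_lebesgue) auto
    then show ?thesis
      using True p by (subst integral_eq_nn_integral) auto
  next
    case False
    \<comment> \<open>The interval is empty or the single point 0, and \<open>0 powr x\<close> is 0
      by convention.\<close>
    then have "indicator {0..s} u * u powr (d - 1) = 0" for u :: real
      using p by (cases "u = 0") (auto simp: indicator_def)
    then have "(LBINT u. indicator {0..s} u * u powr (d - 1)) = 0"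
      by (simp only: integral_zero)
    with False show ?thesis by simp
  qed
  finally show ?thesis
    using G p by (simp add: gkernel_def c_def)
qed

text \<open>With \<open>s = u + v\<close> as second variable, Fubini leaves the convolution of the
  two kernels as inner integral, which \<open>gkernel_convolution_1\<close> evaluates.\<close>

lemma Kop_semigroup:
  assumes f: "exp_bounded 0 f" and p: "\<rho> > 0" "d > 0"
  shows "Kop \<rho> 1 (Kop \<rho> d f) = Kop \<rho> (d + 1) f"
proof
  fix t
  obtain A where A: "\<And>t. \<bar>f t\<bar> \<le> A" using f by (auto simp: exp_bounded_def)
  note [measurable] = exp_bounded_measurable[OF f]
  have I: "integrable lborel (gkernel \<rho> 1)" "integrable lborel (gkernel \<rho> d)"
    using has_bochner_integral_gkernel p by (auto simp: has_bochner_integral_iff)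
  have "integrable (lborel \<Otimes>\<^sub>M lborel)
      (\<lambda>(u, s). gkernel \<rho> 1 u * gkernel \<rho> d (s - 1 * u) * (case (u, s) of (u, s) \<Rightarrow> f (t + s)))"
    using A by (intro integrable_pair_shear_bounded I) (auto simp: borel_prod[symmetric])
  then have *: "integrable (lborel \<Otimes>\<^sub>M lborel)
      (\<lambda>(u, s). gkernel \<rho> 1 u * gkernel \<rho> d (s - u) * f (t + s))" by simp
  have "Kop \<rho> d f (t + u) = (LBINT s. gkernel \<rho> d (s - u) * f (t + s))" for u
    unfolding Kop_eq
    using lborel_integral_real_affine[of 1 "\<lambda>v. gkernel \<rho> d v * f (t + u + v)" "-u"] by simp
  then have "Kop \<rho> 1 (Kop \<rho> d f) t
      = (LBINT u. LBINT s. gkernel \<rho> 1 u * gkernel \<rho> d (s - u) * f (t + s))"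
    by (simp add: Kop_eq[of \<rho> 1] mult.assoc)
  also have "\<dots> = (LBINT s. LBINT u. gkernel \<rho> 1 u * gkernel \<rho> d (s - u) * f (t + s))"
    using lborel_pair.Fubini_integral[OF *] by simp
  also have "\<dots> = Kop \<rho> (d + 1) f t"
    by (simp add: gkernel_convolution_1[OF p] Kop_eq)
  finally show "Kop \<rho> 1 (Kop \<rho> d f) t = Kop \<rho> (d + 1) f t" .
qed

text \<open>The extra operator is commuted inwards until it meets the factor with index
  \<open>j\<close>, where the semigroup law absorbs it into the shape.\<close>

lemma Kop_foldr_raise_shape:
  assumes f: "exp_bounded 0 f" and j: "j \<in> set ls" "distinct ls"
    and p: "\<And>l. l \<in> set ls \<Longrightarrow> \<rho> l > 0 \<and> d l > 0"
  shows "Kop (\<rho> j) 1 (foldr (\<lambda>l. Kop (\<rho> l) (d l)) ls f)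
    = foldr (\<lambda>l. Kop (\<rho> l) (d l + of_bool (l = j))) ls f"
  using j p
proof (induction ls)
  case (Cons l ls)
  have eb: "exp_bounded 0 (foldr (\<lambda>l. Kop (\<rho> l) (d l)) ls f)"
    using Cons.prems by (intro exp_bounded_foldr_Kop f) auto
  show ?case
  proof (cases "l = j")
    case True
    \<comment> \<open>By distinctness \<open>j\<close> does not recur in the tail, so no further
      shape is raised there.\<close>
    then have "foldr (\<lambda>l. Kop (\<rho> l) (d l)) ls f
        = foldr (\<lambda>l. Kop (\<rho> l) (d l + of_bool (l = j))) ls f"
      using Cons.prems by (intro foldr_cong) auto
    with True Kop_semigroup[OF eb, of "\<rho> j" "d j"] Cons.prems show ?thesis by simp
  next
    case False
    then have j: "j \<in> set ls" using Cons.prems by auto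
    have "Kop (\<rho> j) 1 (Kop (\<rho> l) (d l) (foldr (\<lambda>l. Kop (\<rho> l) (d l)) ls f))
      = Kop (\<rho> l) (d l) (Kop (\<rho> j) 1 (foldr (\<lambda>l. Kop (\<rho> l) (d l)) ls f))"
      using Cons.prems j by (intro Kop_commute[OF eb]) auto
    with False j Cons show ?thesis by simp
  qed
qed simp

subsection \<open>Rescaling the Laguerre rows\<close>

text \<open>For \<open>y < 0\<close> the interval integral is minus the integral over the interval
  from \<open>y\<close> to 0, where \<open>f\<close> vanishes. Thus iterated convolutions stay
  supported on the positive half-line.\<close>

lemma pconv_nonpos:
  assumes "\<And>u. u \<le> 0 \<Longrightarrow> f u = 0" "y \<le> 0"
  shows "pconv f g y = 0"
proof -
  have "pconv f g y = - (LBINT u:einterval y 0. f u * g (y - u))"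
    unfolding pconv_def using assms(2)
    by (cases "y = 0")
      (simp_all add: interval_lebesgue_integral_gt_eq zero_ereal_def set_lebesgue_integral_def)
  also have "(LBINT u:einterval y 0. f u * g (y - u)) = (LBINT u:einterval y 0. 0)"
    by (intro set_lebesgue_integral_cong) (auto simp: einterval_def zero_ereal_def assms(1))
  finally show ?thesis by simp
qed

text \<open>The supports of both factors already confine the integrand to the interval from 0 to
  \<open>y\<close>. On the whole line affine substitutions leave the limits alone.\<close>

lemma pconv_eq:
  assumes f: "\<And>u. u \<le> 0 \<Longrightarrow> f u = 0" and g: "\<And>u. u \<le> 0 \<Longrightarrow> g u = 0"
  shows "pconv f g y = (LBINT u. f u * g (y - u))"
proof (cases "y \<le> 0")
  case True
  have "f u * g (y - u) = 0" for u
    using f[of u] g[of "y - u"] True by (cases "u \<le> 0") auto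
  then have "(LBINT u. f u * g (y - u)) = 0" by (simp only: integral_zero)
  then show ?thesis using pconv_nonpos[of f y g] f True by simp
next
  case False
  have eq: "f u * g (y - u) = indicator (einterval 0 y) u *\<^sub>R (f u * g (y - u))" for u
    using f[of u] g[of "y - u"]
    by (cases "u \<le> 0"; cases "y \<le> u") (simp_all add: einterval_def zero_ereal_def)
  have "(LBINT u. f u * g (y - u)) = (LBINT u:einterval 0 y. f u * g (y - u))"
    unfolding set_lebesgue_integral_def by (intro Bochner_Integration.integral_cong refl eq)
  then show ?thesis
    using False by (simp add: pconv_def interval_lebesgue_integral_le_eq zero_ereal_def)
qed

lemma gkernel_nonpos: "u \<le> 0 \<Longrightarrow> gkernel \<rho> d u = 0"
  by (simp add: gkernel_def)

text \<open>After \<open>u \<mapsto> c * u\<close> the argument of \<open>g\<close> is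
  \<open>b - c * (t + u)\<close>: the orientation-reversing change of variable turns a convolution
  into the forward average \<open>Kop\<close>.\<close>

lemma pconv_gkernel_affine:
  assumes g: "\<And>u. u \<le> 0 \<Longrightarrow> g u = 0" and "c > 0" "\<rho> > 0"
  shows "pconv (gkernel (\<rho> / c) d) g (b - c * t) = Kop \<rho> d (\<lambda>t. g (b - c * t)) t"
proof -
  have "pconv (gkernel (\<rho> / c) d) g (b - c * t)
      = c * (LBINT u. gkernel (\<rho> / c) d (c * u) * g (b - c * t - c * u))"
    using lborel_integral_real_affine[of c "\<lambda>u. gkernel (\<rho> / c) d u * g (b - c * t - u)" 0] \<open>c > 0\<close>
    by (simp add: pconv_eq gkernel_nonpos g)
  also have "\<dots> = (LBINT u. (c * gkernel (\<rho> / c) d (c * u)) * g (b - c * t - c * u))"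
    by (simp add: mult.assoc)
  also have "\<dots> = Kop \<rho> d (\<lambda>t. g (b - c * t)) t"
    unfolding gkernel_scale[OF assms(2,3)] Kop_eq by (simp add: distrib_left diff_diff_eq)
  finally show ?thesis .
qed

lemma foldr_pconv_affine:
  assumes g: "\<And>u. u \<le> 0 \<Longrightarrow> g u = 0" and c: "c > 0"
    and p: "\<And>l. l \<in> set ls \<Longrightarrow> \<rho> l > 0"
  shows "foldr (\<lambda>l. pconv (gkernel (\<rho> l / c) (d l))) ls g (b - c * t)
    = foldr (\<lambda>l. Kop (\<rho> l) (d l)) ls (\<lambda>t. g (b - c * t)) t"
  using p
proof (induction ls arbitrary: t)
  case (Cons l ls)
  \<comment> \<open>The tail has to vanish on the nonpositive axis to play the role of
    \<open>g\<close>: it is \<open>g\<close> itself or a convolution led by a kernel.\<close>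
  have "foldr (\<lambda>l. pconv (gkernel (\<rho> l / c) (d l))) ls g u = 0" if "u \<le> 0" for u
    using that g by (cases ls) (auto intro!: pconv_nonpos gkernel_nonpos)
  then show ?case
    using Cons c by (simp add: pconv_gkernel_affine)
qed simp

lemma Kop_cmult: "Kop \<rho> d (\<lambda>t. c * f t) t = c * Kop \<rho> d f t"
  by (simp add: Kop_eq mult.left_commute[of _ c])

lemma foldr_Kop_cmult:
  "foldr (\<lambda>l. Kop (\<rho> l) (d l)) ls (\<lambda>t. c * f t) = (\<lambda>t. c * foldr (\<lambda>l. Kop (\<rho> l) (d l)) ls f t)"
  by (induction ls) (auto simp: Kop_cmult)

text \<open>The case \<open>r = 0\<close> of the transformed row, with shape \<open>\<tau> + e\<close>.\<close>

definition lagG :: "real \<Rightarrow> real \<Rightarrow> real \<Rightarrow> real \<Rightarrow> real" where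
  "lagG a e \<tau> t = hscale \<tau> * gkernel 1 (\<tau> + e) (\<tau> + hscale \<tau> * (a - t))"

text \<open>The factor of index \<open>r + 1\<close> has rate 1 and seeds the fold, so it keeps its
  rate and becomes \<open>lagG\<close>, with the outer \<open>hscale \<tau>\<close> drawn in by
  linearity. Its shape is raised only if \<open>j = r + 1\<close>.\<close>

lemma lagV_eq:
  assumes \<tau>: "\<tau> > 0" and \<rho>: "\<And>h. h \<in> {1..r} \<Longrightarrow> \<rho> h > 0"
  shows "lagV r \<rho> d a j \<tau> = foldr (\<lambda>l. Kop (\<rho> l) (d l + of_bool (l = j))) [1..<r + 1]
    (lagG a (of_bool (j = r + 1)) \<tau>)"
proof
  fix t
  let ?h = "hscale \<tau>"
  let ?g = "gkernel 1 (\<tau> + of_bool (j = r + 1))"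
  have h: "?h > 0" using \<tau> by (simp add: hscale_def)
  have y: "\<tau> + ?h * (a - t) = (\<tau> + ?h * a) - ?h * t" for t by (simp add: algebra_simps)
  have "lagRow r \<rho> d j \<tau> = foldr (\<lambda>l. pconv (gkernel (\<rho> l / ?h) (d l + of_bool (l = j)))) [1..<r + 1] ?g"
    unfolding lagRow_def
    by (intro foldr_cong) (auto simp: lagFactor_def rate_def shape_def)
  then have "lagV r \<rho> d a j \<tau> t = ?h * foldr (\<lambda>l. Kop (\<rho> l) (d l + of_bool (l = j))) [1..<r + 1]
      (\<lambda>t. ?g ((\<tau> + ?h * a) - ?h * t)) t"
    unfolding lagV_def y
    using foldr_pconv_affine[of ?g ?h "[1..<r + 1]" \<rho> "\<lambda>l. d l + of_bool (l = j)" "\<tau> + ?h * a" t]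
      h \<rho> by (simp add: gkernel_nonpos del: upt_Suc)
  then show "lagV r \<rho> d a j \<tau> t = foldr (\<lambda>l. Kop (\<rho> l) (d l + of_bool (l = j))) [1..<r + 1]
      (lagG a (of_bool (j = r + 1)) \<tau>) t"
    unfolding lagG_def[abs_def] foldr_Kop_cmult y .
qed

subsection \<open>Pointwise comparison of Gamma and Gauss profiles\<close>

text \<open>The remainder \<open>F\<close> has derivative \<open>- (z\<^sup>2 / (1 - z))\<close>,
  which for \<open>z \<le> 1/2\<close> lies between \<open>- 3 * z\<^sup>2\<close> and 0. So
  \<open>F\<close> decreases and \<open>F z + z ^ 3\<close> increases; comparing with 0 handles both
  signs of \<open>z\<close>.\<close>

lemma ln_one_minus_cubic:
  fixes z :: real
  assumes "z \<le> 1/2"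
  shows "\<bar>ln (1 - z) + z + z\<^sup>2 / 2\<bar> \<le> \<bar>z\<bar> ^ 3"
proof -
  define F where "F z = ln (1 - z) + z + z\<^sup>2 / 2" for z :: real
  have dF: "(F has_real_derivative - (z\<^sup>2 / (1 - z))) (at z)" if "z \<le> 1/2" for z
    unfolding F_def[abs_def] using that
    by (auto intro!: derivative_eq_intros simp: field_simps power2_eq_square)
  have dH: "((\<lambda>z. F z + z ^ 3) has_real_derivative (3 * z\<^sup>2 - z\<^sup>2 / (1 - z))) (at z)"
    if "z \<le> 1/2" for z
    using dF[OF that] by (auto intro!: derivative_eq_intros)
  have pos: "0 \<le> z\<^sup>2 / (1 - z)" "0 \<le> 3 * z\<^sup>2 - z\<^sup>2 / (1 - z)" if "z \<le> 1/2" for z :: real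
  proof -
    have "z\<^sup>2 / (1 - z) \<le> z\<^sup>2 / (1/2)"
      using that by (intro divide_left_mono) auto
    also have "\<dots> \<le> 3 * z\<^sup>2" by simp
    finally show "0 \<le> 3 * z\<^sup>2 - z\<^sup>2 / (1 - z)" by simp
    show "0 \<le> z\<^sup>2 / (1 - z)" using that by auto
  qed
  have F0: "F 0 = 0" by (simp add: F_def)
  have F_mono: "F y \<le> F x" if "x \<le> y" "y \<le> 1/2" for x y
    using that(1)
  proof (rule DERIV_nonpos_imp_nonincreasing)
    fix w assume "x \<le> w" "w \<le> y"
    then show "\<exists>D. (F has_real_derivative D) (at w) \<and> D \<le> 0"
      using dF[of w] pos(1)[of w] that by (intro exI[of _ "- (w\<^sup>2 / (1 - w))"]) auto
  qed
  have H_mono: "F x + x ^ 3 \<le> F y + y ^ 3" if "x \<le> y" "y \<le> 1/2" for x y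
    using that(1)
  proof (rule DERIV_nonneg_imp_nondecreasing)
    fix w assume "x \<le> w" "w \<le> y"
    then show "\<exists>D. ((\<lambda>z. F z + z ^ 3) has_real_derivative D) (at w) \<and> D \<ge> 0"
      using dH[of w] pos(2)[of w] that by (intro exI[of _ "3 * w\<^sup>2 - w\<^sup>2 / (1 - w)"]) auto
  qed
  show ?thesis
  proof (cases "z \<ge> 0")
    case True
    then show ?thesis using F_mono[of 0 z] H_mono[of 0 z] assms F0 by (simp add: F_def)
  next
    case False
    then show ?thesis using F_mono[of z 0] H_mono[of z 0] F0 by (simp add: F_def)
  qed
qed

text \<open>An upper bound on the whole domain, quadratic near 0 and linear as \<open>z\<close>
  tends to minus infinity; it controls the tail of the Gamma profile.\<close>

lemma ln_one_minus_quadratic: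
  fixes z :: real
  assumes "z < 1"
  shows "ln (1 - z) + z \<le> - (z\<^sup>2 / (2 * (1 + \<bar>z\<bar>)))"
proof (cases "z \<ge> 0")
  case True
  have "ln (1 - z) + z + z\<^sup>2 / 2 \<le> ln (1 - 0) + 0 + 0\<^sup>2 / 2"
    using True
  proof (rule DERIV_nonpos_imp_nonincreasing)
    fix x assume "0 \<le> x" "x \<le> z"
    then show "\<exists>y. ((\<lambda>z. ln (1 - z) + z + z\<^sup>2 / 2) has_real_derivative y) (at x) \<and> y \<le> 0"
      using assms
      by (intro exI[of _ "- (x\<^sup>2 / (1 - x))"] conjI)
        (auto intro!: derivative_eq_intros simp: field_simps power2_eq_square)
  qed
  moreover have "z\<^sup>2 / (2 * (1 + \<bar>z\<bar>)) \<le> z\<^sup>2 / 2"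
    by (intro divide_left_mono) auto
  ultimately show ?thesis by simp
next
  case False
  \<comment> \<open>In terms of \<open>w = - z\<close> this is
    \<open>ln (1 + w) - w + w\<^sup>2 / (2 * (1 + w))\<close>, with the fraction split so that its
    derivative becomes minus half a square.\<close>
  define D where "D w = ln (1 + w) - w + (w - 1 + 1 / (1 + w)) / 2" for w :: real
  have "0 \<le> - z" using False by simp
  then have "D (- z) \<le> D 0"
  proof (rule DERIV_nonpos_imp_nonincreasing)
    fix w :: real assume w: "0 \<le> w" "w \<le> - z"
    have "(D has_real_derivative (1 / (1 + w) - 1 + (1 - 1 / (1 + w)\<^sup>2) / 2)) (at w)"
      unfolding D_def[abs_def] using w
      by (auto intro!: derivative_eq_intros simp: power2_eq_square inverse_eq_divide)
    moreover have "1 / (1 + w) - 1 + (1 - 1 / (1 + w)\<^sup>2) / 2 = - ((1 / (1 + w) - 1)\<^sup>2 / 2)"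
    proof -
      define y where "y = 1 / (1 + w)"
      then have "1 / (1 + w)\<^sup>2 = y\<^sup>2" by (simp add: power_one_over)
      then show ?thesis
        unfolding y_def[symmetric] by (simp add: power2_eq_square field_simps)
    qed
    ultimately show "\<exists>y. (D has_real_derivative y) (at w) \<and> y \<le> 0"
      by (intro exI[of _ "- ((1 / (1 + w) - 1)\<^sup>2 / 2)"]) simp
  qed
  moreover have "D 0 = 0" "D (- z) = ln (1 - z) + z + (- z - 1 + 1 / (1 - z)) / 2"
    by (simp_all add: D_def)
  moreover have "z\<^sup>2 / (2 * (1 + \<bar>z\<bar>)) = (- z - 1 + 1 / (1 - z)) / 2"
    using False by (simp add: field_simps power2_eq_square)
  ultimately show ?thesis by linarith
qed

text \<open>Both sides come from \<open>ln x \<le> x - 1\<close>, applied to \<open>1 - z\<close>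
  and to its reciprocal.\<close>

lemma abs_ln_one_minus_le:
  fixes z :: real
  assumes "z \<le> 1/2"
  shows "\<bar>ln (1 - z)\<bar> \<le> 2 * \<bar>z\<bar>"
proof -
  have "ln (1 - z) \<le> - z" using assms ln_le_minus_one[of "1 - z"] by simp
  moreover have "- ln (1 - z) \<le> z / (1 - z)"
    using assms ln_le_minus_one[of "1 / (1 - z)"] by (simp add: ln_div field_simps)
  moreover have "z / (1 - z) \<le> 2 * \<bar>z\<bar>"
  proof (cases "z \<ge> 0")
    case True
    then have "z / (1 - z) \<le> z / (1/2)" using assms by (intro divide_left_mono) auto
    with True show ?thesis by simp
  next
    case False
    then have "z / (1 - z) \<le> 0" using assms by (intro divide_nonpos_pos) auto
    then show ?thesis by simp
  qed
  ultimately show ?thesis by linarith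
qed

text \<open>Convexity of \<open>exp\<close>. The symmetric factor allows exponents to be compared
  without knowing which is larger.\<close>

lemma abs_exp_diff_le:
  fixes x y :: real
  shows "\<bar>exp x - exp y\<bar> \<le> \<bar>x - y\<bar> * (exp x + exp y)"
proof -
  have *: "exp x - exp y \<le> (x - y) * exp x" for x y :: real
  proof -
    have "exp x * (1 + (y - x)) \<le> exp x * exp (y - x)"
      by (intro mult_left_mono exp_ge_add_one_self) auto
    then show ?thesis by (simp add: exp_diff algebra_simps)
  qed
  show ?thesis
  proof (cases "x \<ge> y")
    case True
    then show ?thesis using *[of x y] by (simp add: distrib_left add_increasing2)
  next
    case False
    then show ?thesis using *[of y x] by (simp add: distrib_left add_increasing)
  qed
qed

text \<open>The rescaled Gamma density without its normalizing constant; \<open>s\<close> is \<open>sqrt (2 / \<tau>)\<close>, so that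
  \<open>2 / s\<^sup>2 = \<tau>\<close>.\<close>

definition lagProfile :: "real \<Rightarrow> real \<Rightarrow> real \<Rightarrow> real" where
  "lagProfile e s x = (if s * x < 1 then exp ((2 / s\<^sup>2 - e) * ln (1 - s * x) + 2 / s * x) else 0)"

lemma lagProfile_nonneg: "lagProfile e s x \<ge> 0"
  by (simp add: lagProfile_def)

lemma borel_measurable_lagProfile [measurable]: "lagProfile e s \<in> borel_measurable borel"
  unfolding lagProfile_def[abs_def] by measurable

text \<open>For \<open>s * x \<le> 1/2\<close> the exponents are compared by Taylor expansion.
  Otherwise \<open>2 * s * \<bar>x\<bar>\<close> exceeds 1 and the claim is the triangle inequality;
  this also covers the cutoff of the profile.\<close>

lemma lagProfile_diff_le:
  assumes s: "s > 0" and e: "0 \<le> e" "e \<le> 1"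
  shows "\<bar>lagProfile e s x - exp (- x\<^sup>2)\<bar>
    \<le> 2 * s * (\<bar>x\<bar> + \<bar>x\<bar> ^ 3) * (lagProfile e s x + exp (- x\<^sup>2))"
proof (cases "s * x \<le> 1/2")
  case True
  define z where "z = s * x"
  define E where "E = (2 / s\<^sup>2 - e) * ln (1 - z) + 2 / s * x"
  have g: "lagProfile e s x = exp E" using True by (simp add: lagProfile_def E_def z_def)
  \<comment> \<open>Written in \<open>z\<close>, the linear term and the Gaussian exponent complete
    the logarithm to its cubic remainder.\<close>
  have x2: "2 / s * x = 2 / s\<^sup>2 * z" "x\<^sup>2 = 2 / s\<^sup>2 * (z\<^sup>2 / 2)"
    using s by (auto simp: z_def power2_eq_square)
  have "E - - x\<^sup>2 = 2 / s\<^sup>2 * (ln (1 - z) + z + z\<^sup>2 / 2) - e * ln (1 - z)"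
    unfolding E_def x2 by (simp add: algebra_simps)
  also have "\<bar>\<dots>\<bar> \<le> 2 / s\<^sup>2 * \<bar>ln (1 - z) + z + z\<^sup>2 / 2\<bar> + e * \<bar>ln (1 - z)\<bar>"
    using e abs_triangle_ineq4[of "2 / s\<^sup>2 * (ln (1 - z) + z + z\<^sup>2 / 2)" "e * ln (1 - z)"]
    by (simp only: abs_mult abs_divide abs_numeral abs_power2 abs_of_nonneg)
  also have "\<dots> \<le> 2 / s\<^sup>2 * \<bar>z\<bar> ^ 3 + 1 * (2 * \<bar>z\<bar>)"
    using e True ln_one_minus_cubic[of z] abs_ln_one_minus_le[of z]
    by (intro add_mono mult_mono) (auto simp: z_def)
  also have "\<dots> = 2 * s * (\<bar>x\<bar> + \<bar>x\<bar> ^ 3)"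
    using s by (simp add: z_def abs_mult power_mult_distrib power2_eq_square power3_eq_cube field_simps)
  finally have "\<bar>E - - x\<^sup>2\<bar> \<le> 2 * s * (\<bar>x\<bar> + \<bar>x\<bar> ^ 3)" .
  then have "\<bar>E - - x\<^sup>2\<bar> * (exp E + exp (- x\<^sup>2)) \<le> 2 * s * (\<bar>x\<bar> + \<bar>x\<bar> ^ 3) * (exp E + exp (- x\<^sup>2))"
    by (intro mult_right_mono) auto
  then show ?thesis unfolding g using abs_exp_diff_le[of E "- x\<^sup>2"] by linarith
next
  case False
  then have "x > 0" using s mult_nonneg_nonpos[of s x] by linarith
  then have "1 \<le> 2 * s * (\<bar>x\<bar> + \<bar>x\<bar> ^ 3)"
    using False s mult_pos_pos[of s "x ^ 3"] zero_less_power[of x 3]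
    by (simp add: distrib_left mult_ac del: zero_less_power mult_pos_pos)
  then have *: "1 * (lagProfile e s x + exp (- x\<^sup>2))
      \<le> 2 * s * (\<bar>x\<bar> + \<bar>x\<bar> ^ 3) * (lagProfile e s x + exp (- x\<^sup>2))"
    by (intro mult_right_mono) (auto simp: lagProfile_nonneg)
  have "\<bar>lagProfile e s x - exp (- x\<^sup>2)\<bar> \<le> 1 * (lagProfile e s x + exp (- x\<^sup>2))"
    using lagProfile_nonneg[of e s x] exp_gt_zero[of "- x\<^sup>2"] unfolding abs_le_iff by simp
  from this * show ?thesis by (rule order.trans)
qed

text \<open>A domination uniform in \<open>s\<close>. The exponent is at most
  \<open>1 - x\<^sup>2 / (2 * (1 + s * \<bar>x\<bar>))\<close>, whose limiting slope
  \<open>1 / (2 * s)\<close> in absolute value is at least \<open>2 * M\<close> by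
  \<open>4 * M * s \<le> 1\<close>.\<close>

lemma lagProfile_le:
  assumes s: "s > 0" "s \<le> 1" "4 * M * s \<le> 1" and M: "M > 0" and e: "0 \<le> e" "e \<le> 1"
  shows "lagProfile e s x \<le> exp (1 + M\<^sup>2 - M * \<bar>x\<bar>)"
proof (cases "s * x < 1")
  case True
  define z where "z = s * x"
  have z: "z < 1" using True by (simp add: z_def)
  define L where "L = ln (1 - z) + z"
  have L: "L \<le> - (z\<^sup>2 / (2 * (1 + \<bar>z\<bar>)))"
    using ln_one_minus_quadratic[OF z] by (simp add: L_def)
  then have L0: "L \<le> 0" by (rule order.trans) auto
  \<comment> \<open>One of the two copies of \<open>1 / s\<^sup>2\<close> in the exponent absorbs
    \<open>e\<close>.\<close>
  have s2: "1 \<le> 1 / s\<^sup>2" using s by (simp add: power_le_one)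
  have "(2 / s\<^sup>2 - e) * ln (1 - z) + 2 / s * x = (2 / s\<^sup>2 - e) * L + e * z"
    using s by (simp add: L_def z_def power2_eq_square algebra_simps)
  also have "\<dots> \<le> (1 / s\<^sup>2) * L + 1"
  proof (intro add_mono mult_right_mono_neg[OF _ L0])
    show "1 / s\<^sup>2 \<le> 2 / s\<^sup>2 - e" using e s2 by simp
    show "e * z \<le> 1" using mult_left_mono[of z 1 e] z e by simp
  qed
  also have "\<dots> \<le> (1 / s\<^sup>2) * (- (z\<^sup>2 / (2 * (1 + \<bar>z\<bar>)))) + 1"
    by (intro add_mono mult_left_mono L) auto
  also have "\<dots> = 1 - x\<^sup>2 / (2 * (1 + s * \<bar>x\<bar>))"
    using s by (simp add: z_def abs_mult power_mult_distrib)
  also have "\<dots> \<le> 1 + M\<^sup>2 - M * \<bar>x\<bar>"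
  proof -
    define u where "u = \<bar>x\<bar>"
    have u: "u \<ge> 0" by (simp add: u_def)
    have "M * u - M\<^sup>2 \<le> u\<^sup>2 / (2 * (1 + s * u))"
    proof (cases "M * u - M\<^sup>2 \<le> 0")
      case True
      then show ?thesis using u s by (intro order.trans[OF True]) auto
    next
      case False
      have Msu: "4 * M * s * u \<le> u" using mult_right_mono[OF s(3) u] by simp
      have "(M * u - M\<^sup>2) * (2 * (1 + s * u)) = 2 * (M * u - M\<^sup>2) + 2 * (M * s * u) * (u - M)"
        by (simp add: power2_eq_square algebra_simps)
      also have "u - M \<ge> 0"
        using False M by (smt (verit) power2_eq_square mult_left_mono)
      then have "2 * (M * u - M\<^sup>2) + 2 * (M * s * u) * (u - M) \<le> 2 * (M * u - M\<^sup>2) + u / 2 * (u - M)"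
        using Msu by (intro add_left_mono mult_right_mono) auto
      also have "\<dots> \<le> u\<^sup>2"
      proof -
        \<comment> \<open>This is the right side minus the left side, with the square
          completed.\<close>
        have "0 \<le> (u - 2 * M)\<^sup>2 / 2 + u * M / 2" using M u by auto
        then show ?thesis by (simp add: power2_eq_square field_simps)
      qed
      finally show ?thesis using u s by (simp add: pos_le_divide_eq add_pos_nonneg)
    qed
    then show ?thesis by (simp add: u_def)
  qed
  finally show ?thesis using True by (simp add: lagProfile_def z_def)
qed (simp add: lagProfile_def)

lemma gauss_le_exp:
  fixes x M :: real
  shows "exp (- x\<^sup>2) \<le> exp (1 + M\<^sup>2 - M * \<bar>x\<bar>)"
proof -
  have "0 \<le> (\<bar>x\<bar> - M / 2)\<^sup>2 + 3 / 4 * M\<^sup>2 + 1" by simp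
  then show ?thesis by (simp add: power2_eq_square field_simps)
qed

lemma power_div_fact_le_exp:
  fixes u :: real
  assumes "u \<ge> 0"
  shows "u ^ n / fact n \<le> exp u"
  using sum_le_suminf[OF sums_summable[OF exp_converges[of u]], of "{n}"]
    sums_unique[OF exp_converges[of u]] assms
  by (simp add: divide_inverse mult.commute)

lemma poly_le_exp:
  fixes u :: real
  assumes "u \<ge> 0"
  shows "u + u ^ 3 \<le> 7 * exp u"
proof -
  \<comment> \<open>The constant is \<open>7 = 1! + 3!\<close>.\<close>
  from power_div_fact_le_exp[of u 1] power_div_fact_le_exp[of u 3] assms show ?thesis by (simp add: eval_nat_numeral)
qed

text \<open>Domination is used at rate \<open>M + 1\<close>, so that one unit of decay pays for the
  polynomial \<open>\<bar>x\<bar> + \<bar>x\<bar> ^ 3\<close>. The constant is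
  \<open>28 = 2 * 7 * 2\<close>.\<close>

lemma lagProfile_exp_decay:
  assumes s: "s > 0" "s \<le> 1" "4 * (M + 1) * s \<le> 1" and M: "M \<ge> 0" and e: "0 \<le> e" "e \<le> 1"
  shows "\<bar>lagProfile e s x - exp (- x\<^sup>2)\<bar> \<le> 28 * exp (1 + (M + 1)\<^sup>2) * s * exp (- M * \<bar>x\<bar>)"
proof -
  let ?E = "exp (1 + (M + 1)\<^sup>2 - (M + 1) * \<bar>x\<bar>)"
  have "\<bar>lagProfile e s x - exp (- x\<^sup>2)\<bar>
    \<le> 2 * s * (\<bar>x\<bar> + \<bar>x\<bar> ^ 3) * (lagProfile e s x + exp (- x\<^sup>2))"
    by (rule lagProfile_diff_le[OF s(1) e])
  also have "\<dots> \<le> 2 * s * (7 * exp \<bar>x\<bar>) * (?E + ?E)"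
    using s M e poly_le_exp[of "\<bar>x\<bar>"]
    by (intro mult_mono add_mono lagProfile_le gauss_le_exp) (auto simp: lagProfile_nonneg)
  also have "\<dots> = 28 * s * (exp \<bar>x\<bar> * ?E)" by simp
  also have "exp \<bar>x\<bar> * ?E = exp (1 + (M + 1)\<^sup>2) * exp (- M * \<bar>x\<bar>)"
    unfolding exp_add[symmetric] by (simp add: algebra_simps)
  finally show ?thesis by (simp add: mult_ac)
qed

subsection \<open>The normalizing constant\<close>

lemma integrable_exp_minus_abs:
  fixes \<delta> :: real
  assumes "\<delta> > 0"
  shows "integrable lborel (\<lambda>x. exp (- \<delta> * \<bar>x\<bar>))"
proof -
  have 1: "integrable lborel (\<lambda>x. indicator {0..} x *\<^sub>R exp (- \<delta> * x))"
    using nonnegative_absolutely_integrable_1[OF integrable_on_exp_minus_to_infinity[OF assms, of 0]]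
    unfolding set_integrable_def by (simp add: integrable_completion)
  then have "integrable lborel (\<lambda>x. indicator {0..} (- x) *\<^sub>R exp (- \<delta> * (- x)))"
    using lborel_integrable_real_affine[OF 1, of "-1" 0] by simp
  with 1 have "integrable lborel (\<lambda>x. indicator {0..} x *\<^sub>R exp (- \<delta> * x)
      + indicator {0..} (- x) *\<^sub>R exp (- \<delta> * (- x)))"
    by (rule Bochner_Integration.integrable_add)
  \<comment> \<open>The two half-lines overlap at 0, so their sum dominates the integrand instead of
    equalling it.\<close>
  then show ?thesis
    by (rule Bochner_Integration.integrable_bound) (auto simp: indicator_def)
qed

text \<open>Half of the decay absorbs the power, by one term of the exponential series at
  \<open>\<delta> / 2 * \<bar>x\<bar>\<close>.\<close>

lemma integrable_power_exp_minus_abs: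
  fixes \<delta> :: real
  assumes "\<delta> > 0"
  shows "integrable lborel (\<lambda>x. \<bar>x\<bar> ^ v * exp (- \<delta> * \<bar>x\<bar>))"
proof (rule Bochner_Integration.integrable_bound)
  let ?K = "fact v / (\<delta> / 2) ^ v"
  show "integrable lborel (\<lambda>x. ?K * exp (- (\<delta> / 2) * \<bar>x\<bar>))"
    using assms by (intro integrable_mult_right integrable_exp_minus_abs) auto
  have "\<bar>x\<bar> ^ v * exp (- \<delta> * \<bar>x\<bar>) \<le> ?K * exp (- (\<delta> / 2) * \<bar>x\<bar>)" for x
  proof -
    have "\<bar>x\<bar> ^ v \<le> ?K * exp (\<delta> / 2 * \<bar>x\<bar>)"
      using power_div_fact_le_exp[of "\<delta> / 2 * \<bar>x\<bar>" v] assms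
      by (simp add: power_mult_distrib power_divide field_simps)
    then have "\<bar>x\<bar> ^ v * exp (- \<delta> * \<bar>x\<bar>) \<le> ?K * exp (\<delta> / 2 * \<bar>x\<bar>) * exp (- \<delta> * \<bar>x\<bar>)"
      by (rule mult_right_mono) simp
    also have "\<dots> = ?K * exp (- (\<delta> / 2) * \<bar>x\<bar>)"
      by (simp add: mult.assoc exp_add[symmetric])
    finally show ?thesis .
  qed
  then show "AE x in lborel. norm (\<bar>x\<bar> ^ v * exp (- \<delta> * \<bar>x\<bar>)) \<le> norm (?K * exp (- (\<delta> / 2) * \<bar>x\<bar>))"
    using assms by (intro AE_I2) (simp add: abs_mult)
qed measurable

lemma has_bochner_integral_gaussian:
  "has_bochner_integral lborel (\<lambda>x. exp (- x\<^sup>2)) (sqrt pi)"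
proof -
  have "exp (- x\<^sup>2) = sqrt pi * normal_density 0 (1 / sqrt 2) x" for x :: real
    by (simp add: normal_density_def power_divide)
  moreover have "has_bochner_integral lborel (normal_density 0 (1 / sqrt 2)) 1"
    by (simp add: has_bochner_integral_iff)
  from has_bochner_integral_mult_right[OF this, of "sqrt pi"]
  have "has_bochner_integral lborel (\<lambda>x. sqrt pi * normal_density 0 (1 / sqrt 2) x) (sqrt pi)"
    by simp
  ultimately show ?thesis by simp
qed

text \<open>The prefactor shared by both shapes of \<open>lagG\<close>. That it tends to
  \<open>1 / sqrt pi\<close> is the content of Stirling's formula.\<close>

definition lagConst :: "real \<Rightarrow> real" where
  "lagConst \<tau> = hscale \<tau> * \<tau> powr \<tau> * exp (- \<tau>) / Gamma (\<tau> + 1)"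

lemma lagConst_pos: "\<tau> > 0 \<Longrightarrow> lagConst \<tau> > 0"
  by (simp add: lagConst_def hscale_def Gamma_real_pos)

text \<open>With \<open>z = s * (t - a)\<close> the Gamma argument is
  \<open>\<tau> * (1 - z)\<close>. The power \<open>\<tau> + e - 1\<close> equals
  \<open>2 / s\<^sup>2 - (1 - e)\<close>, hence the parameter \<open>1 - e\<close>; the prefactors
  for both \<open>e\<close> agree since
  \<open>Gamma (\<tau> + 1) = \<tau> * Gamma \<tau>\<close>.\<close>

lemma lagG_eq:
  assumes \<tau>: "\<tau> > 0" and e: "e = 0 \<or> e = 1"
  shows "lagG a e \<tau> t = lagConst \<tau> * lagProfile (1 - e) (sqrt (2 / \<tau>)) (t - a)"
proof -
  define s where "s = sqrt (2 / \<tau>)"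
  define z where "z = s * (t - a)"
  have s: "s > 0" "2 / s\<^sup>2 = \<tau>" using \<tau> by (auto simp: s_def)
  have h: "hscale \<tau> = \<tau> * s"
    using \<tau> by (simp add: hscale_def s_def real_sqrt_divide real_sqrt_mult field_simps)
  have y: "\<tau> + hscale \<tau> * (a - t) = \<tau> * (1 - z)"
    by (simp add: h z_def algebra_simps)
  have \<tau>z: "2 / s * (t - a) = \<tau> * z"
    using s by (simp add: z_def s(2)[symmetric] power2_eq_square)
  show ?thesis
  proof (cases "z < 1")
    case True
    have G: "Gamma (\<tau> + 1) = \<tau> * Gamma \<tau>"
      using \<tau> by (intro Gamma_plus1) (auto elim!: nonpos_Ints_cases)
    have c: "hscale \<tau> * \<tau> powr (\<tau> + e - 1) * exp (- \<tau>) / Gamma (\<tau> + e) = lagConst \<tau>"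
      using e
    proof
      assume "e = 0"
      then show ?thesis using \<tau> by (simp add: lagConst_def G powr_diff)
    next
      assume "e = 1"
      then show ?thesis by (simp add: lagConst_def)
    qed
    have "lagG a e \<tau> t = hscale \<tau> * (1 / Gamma (\<tau> + e) * (\<tau> * (1 - z)) powr (\<tau> + e - 1) * exp (- (\<tau> * (1 - z))))"
      using \<tau> True by (simp add: lagG_def gkernel_def y)
    also have "(\<tau> * (1 - z)) powr (\<tau> + e - 1) = \<tau> powr (\<tau> + e - 1) * exp ((\<tau> + e - 1) * ln (1 - z))"
      using \<tau> True by (simp add: powr_def ln_mult distrib_left exp_add)
    also have "exp (- (\<tau> * (1 - z))) = exp (- \<tau>) * exp (\<tau> * z)"
      by (simp add: exp_add[symmetric] algebra_simps)
    finally have "lagG a e \<tau> t = lagConst \<tau> * (exp ((\<tau> + e - 1) * ln (1 - z)) * exp (\<tau> * z))"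
      unfolding c[symmetric] by (simp add: mult_ac)
    also have "exp ((\<tau> + e - 1) * ln (1 - z)) * exp (\<tau> * z) = lagProfile (1 - e) s (t - a)"
      unfolding lagProfile_def s(2) \<tau>z z_def[symmetric] exp_add[symmetric]
      using True by (simp add: diff_diff_eq2)
    finally show ?thesis by (simp add: s_def)
  next
    case False
    then have "\<not> \<tau> * (1 - z) > 0" using \<tau> by (simp add: zero_less_mult_iff)
    with False show ?thesis
      by (simp add: lagG_def gkernel_def y lagProfile_def z_def[symmetric] s_def[symmetric])
  qed
qed

lemma has_bochner_integral_lagG:
  assumes "\<tau> > 0" "\<tau> + e > 0"
  shows "has_bochner_integral lborel (lagG a e \<tau>) 1"
proof -
  have h: "hscale \<tau> > 0" using assms by (simp add: hscale_def)
  have "has_bochner_integral lborel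
      (\<lambda>t. gkernel 1 (\<tau> + e) ((\<tau> + hscale \<tau> * a) + (- hscale \<tau>) * t)) (1 /\<^sub>R \<bar>- hscale \<tau>\<bar>)"
    using lborel_has_bochner_integral_real_affine_iff[of "- hscale \<tau>" "gkernel 1 (\<tau> + e)" 1
        "\<tau> + hscale \<tau> * a"] has_bochner_integral_gkernel[of 1 "\<tau> + e"] h assms by simp
  then have "has_bochner_integral lborel
      (\<lambda>t. hscale \<tau> * gkernel 1 (\<tau> + e) ((\<tau> + hscale \<tau> * a) + (- hscale \<tau>) * t))
      (hscale \<tau> * (1 /\<^sub>R \<bar>- hscale \<tau>\<bar>))"
    by (rule has_bochner_integral_mult_right)
  then show ?thesis using h by (simp add: lagG_def[abs_def] algebra_simps)
qed

text \<open>Both \<open>lagConst \<tau> * lagProfile 0 s\<close> and \<open>exp (- x\<^sup>2) / sqrt pi\<close> have integral one.\<close>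

lemma lagConst_approx:
  "\<exists>K\<ge>0. eventually (\<lambda>\<tau>. lagConst \<tau> \<le> 2 \<and> \<bar>lagConst \<tau> - 1 / sqrt pi\<bar> \<le> K * sqrt (2 / \<tau>)) at_top"
proof -
  define I where "I = (LBINT x. exp (- 1 * \<bar>x::real\<bar>))"
  define K where "K = 28 * exp (1 + (1 + 1)\<^sup>2) * I"
  have int: "integrable lborel (\<lambda>x::real. exp (- 1 * \<bar>x\<bar>))"
    by (rule integrable_exp_minus_abs) simp
  have K0: "K \<ge> 0" unfolding K_def I_def by simp
  have lim: "((\<lambda>\<tau>. sqrt (2 / \<tau>)) \<longlongrightarrow> 0) at_top" by real_asymp
  have sp: "sqrt pi > 1" using pi_gt3 by simp
  \<comment> \<open>The bound \<open>1/8\<close> is the smallness condition of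
    \<open>lagProfile_exp_decay\<close> for \<open>M = 1\<close>; the other bound gives
    \<open>K * s \<le> 1 / 2\<close>, which keeps \<open>J\<close> away from 0.\<close>
  have "eventually (\<lambda>\<tau>. sqrt (2 / \<tau>) < min (1/8) (1 / (2 * K + 2))) at_top"
    using K0 by (intro order_tendstoD[OF lim]) auto
  moreover have "eventually (\<lambda>\<tau>::real. \<tau> > 0) at_top" by (rule eventually_gt_at_top)
  ultimately have "eventually (\<lambda>\<tau>. lagConst \<tau> \<le> 2 \<and> \<bar>lagConst \<tau> - 1 / sqrt pi\<bar> \<le> 2 * K * sqrt (2 / \<tau>)) at_top"
  proof eventually_elim
    case (elim \<tau>)
    define s where "s = sqrt (2 / \<tau>)"
    have s: "s > 0" "s \<le> 1/8" "s \<le> 1 / (2 * K + 2)" using elim by (auto simp: s_def)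
    define J where "J = (LBINT x. lagProfile 0 s x)"
    have cpos: "lagConst \<tau> > 0" using elim by (simp add: lagConst_pos)
    have "has_bochner_integral lborel (\<lambda>x. lagConst \<tau> * lagProfile 0 s x) 1"
    proof -
      have "lagG 0 1 \<tau> = (\<lambda>x. lagConst \<tau> * lagProfile 0 s x)"
        using lagG_eq[of \<tau> 1 0] elim by (auto simp: s_def)
      then show ?thesis using has_bochner_integral_lagG[of \<tau> 1 0] elim by simp
    qed
    then have "integrable lborel (\<lambda>x. lagConst \<tau> * lagProfile 0 s x)" "lagConst \<tau> * J = 1"
      by (auto simp: has_bochner_integral_iff J_def)
    then have P: "integrable lborel (lagProfile 0 s)" and cJ: "lagConst \<tau> = 1 / J"
      using cpos by (auto simp: eq_divide_eq)
    have "\<bar>J - sqrt pi\<bar> = \<bar>LBINT x. lagProfile 0 s x - exp (- x\<^sup>2)\<bar>"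
      using has_bochner_integral_gaussian P unfolding J_def has_bochner_integral_iff
      by (subst Bochner_Integration.integral_diff) auto
    also have "\<dots> \<le> (LBINT x. \<bar>lagProfile 0 s x - exp (- x\<^sup>2)\<bar>)"
      using integral_norm_bound[of lborel "\<lambda>x. lagProfile 0 s x - exp (- x\<^sup>2)"] by simp
    also have "\<dots> \<le> (LBINT x. 28 * exp (1 + (1 + 1)\<^sup>2) * s * exp (- 1 * \<bar>x\<bar>))"
    proof (rule integral_mono)
      show "integrable lborel (\<lambda>x. \<bar>lagProfile 0 s x - exp (- x\<^sup>2)\<bar>)"
        using has_bochner_integral_gaussian P
        by (intro integrable_abs Bochner_Integration.integrable_diff) (auto simp: has_bochner_integral_iff)
      show "integrable lborel (\<lambda>x. 28 * exp (1 + (1 + 1)\<^sup>2) * s * exp (- 1 * \<bar>x\<bar>))"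
        by (intro integrable_mult_right int)
      show "\<bar>lagProfile 0 s x - exp (- x\<^sup>2)\<bar> \<le> 28 * exp (1 + (1 + 1)\<^sup>2) * s * exp (- 1 * \<bar>x\<bar>)" for x
        using s by (intro lagProfile_exp_decay) auto
    qed
    also have "\<dots> = K * s" by (simp add: K_def I_def)
    finally have J: "\<bar>J - sqrt pi\<bar> \<le> K * s" .
    have "K * s \<le> K * (1 / (2 * K + 2))" using s K0 by (intro mult_left_mono) auto
    also have "\<dots> \<le> 1 / 2" using K0 by (simp add: field_simps)
    finally have J2: "J \<ge> 1/2" using J sp by linarith
    have c2: "lagConst \<tau> \<le> 2" using J2 by (simp add: cJ field_simps)
    \<comment> \<open>Since \<open>lagConst \<tau> * J = 1\<close>, the error of the constant is
      that of the integral \<open>J\<close> up to a bounded factor.\<close>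
    have "lagConst \<tau> - 1 / sqrt pi = lagConst \<tau> / sqrt pi * (sqrt pi - J)"
      using J2 sp by (simp add: cJ field_simps)
    then have "\<bar>lagConst \<tau> - 1 / sqrt pi\<bar> = lagConst \<tau> / sqrt pi * \<bar>J - sqrt pi\<bar>"
      using cpos by (simp add: abs_mult abs_minus_commute)
    also have "\<dots> \<le> 2 * (K * s)"
    proof (intro mult_mono J)
      show "lagConst \<tau> / sqrt pi \<le> 2"
        using frac_le[of 2 "lagConst \<tau>" 1 "sqrt pi"] sp c2 cpos by simp
    qed auto
    finally show ?case using c2 by (simp add: s_def)
  qed
  then show ?thesis using K0 by (intro exI[of _ "2 * K"]) simp
qed

subsection \<open>Approximation of the rows\<close>

lemma exp_minus_abs_diff_le:
  fixes M t a :: real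
  assumes "M \<ge> 0"
  shows "exp (- M * \<bar>t - a\<bar>) \<le> exp (M * \<bar>a\<bar>) * exp (- M * \<bar>t\<bar>)"
proof -
  have "M * \<bar>t\<bar> \<le> M * (\<bar>a\<bar> + \<bar>t - a\<bar>)" using assms by (intro mult_left_mono) auto
  then show ?thesis by (simp add: exp_add[symmetric] algebra_simps)
qed

lemma gauss_exp_decay:
  assumes "M \<ge> 0"
  shows "\<exists>B. \<forall>t. \<bar>gauss a t\<bar> \<le> B * exp (- M * \<bar>t\<bar>)"
proof (intro exI allI)
  fix t
  have "\<bar>gauss a t\<bar> \<le> exp (- (t - a)\<^sup>2)"
    using pi_gt3 by (simp add: gauss_def divide_le_eq)
  also have "\<dots> \<le> exp (1 + M\<^sup>2) * exp (- M * \<bar>t - a\<bar>)"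
    using gauss_le_exp[of "t - a" M] by (simp add: exp_add[symmetric])
  also have "\<dots> \<le> exp (1 + M\<^sup>2) * (exp (M * \<bar>a\<bar>) * exp (- M * \<bar>t\<bar>))"
    by (intro mult_left_mono exp_minus_abs_diff_le assms) simp
  finally show "\<bar>gauss a t\<bar> \<le> exp (1 + M\<^sup>2) * exp (M * \<bar>a\<bar>) * exp (- M * \<bar>t\<bar>)" by (simp add: mult_ac)
qed

text \<open>The error splits into a profile error times the bounded prefactor and the prefactor
  error times a Gaussian; each is of order \<open>sqrt (2 / \<tau>)\<close>.\<close>

lemma lagG_approx:
  assumes M: "M \<ge> 0" and e: "e = 0 \<or> e = 1"
  shows "\<exists>C\<ge>0. eventually (\<lambda>\<tau>. \<forall>t. \<bar>lagG a e \<tau> t - gauss a t\<bar>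
    \<le> C * \<tau> powr (- 1 / 2) * exp (- M * \<bar>t\<bar>)) at_top"
proof -
  obtain K where K: "K \<ge> 0" and ev: "eventually (\<lambda>\<tau>. lagConst \<tau> \<le> 2 \<and>
      \<bar>lagConst \<tau> - 1 / sqrt pi\<bar> \<le> K * sqrt (2 / \<tau>)) at_top"
    using lagConst_approx by auto
  define L where "L = 2 * (28 * exp (1 + (M + 1)\<^sup>2)) + K * exp (1 + M\<^sup>2)"
  have L: "L \<ge> 0" using K by (simp add: L_def)
  have lim: "((\<lambda>\<tau>. sqrt (2 / \<tau>)) \<longlongrightarrow> 0) at_top" by real_asymp
  have "eventually (\<lambda>\<tau>. sqrt (2 / \<tau>) < min 1 (1 / (4 * (M + 1)))) at_top"
    using M by (intro order_tendstoD[OF lim]) auto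
  moreover have "eventually (\<lambda>\<tau>::real. \<tau> > 0) at_top" by (rule eventually_gt_at_top)
  ultimately have "eventually (\<lambda>\<tau>. \<forall>t. \<bar>lagG a e \<tau> t - gauss a t\<bar>
    \<le> (L * sqrt 2 * exp (M * \<bar>a\<bar>)) * \<tau> powr (- 1 / 2) * exp (- M * \<bar>t\<bar>)) at_top"
    using ev
  proof eventually_elim
    case (elim \<tau>)
    define s where "s = sqrt (2 / \<tau>)"
    have s1: "s > 0" "s \<le> 1" "s \<le> 1 / (4 * (M + 1))"
      using elim by (auto simp: s_def)
    have s: "s > 0" "s \<le> 1" "4 * (M + 1) * s \<le> 1"
      using s1 M by (auto simp: field_simps)
    have s_eq: "s = sqrt 2 * \<tau> powr (- 1 / 2)"
      using elim by (simp add: s_def real_sqrt_divide powr_minus_divide powr_half_sqrt)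
    define c where "c = lagConst \<tau>"
    have c: "0 \<le> c" "c \<le> 2" "\<bar>c - 1 / sqrt pi\<bar> \<le> K * s"
      using elim lagConst_pos[of \<tau>] by (auto simp: c_def s_def)
    show ?case
    proof
      fix t
      define x where "x = t - a"
      define P where "P = lagProfile (1 - e) s x"
      have "lagG a e \<tau> t - gauss a t = c * (P - exp (- x\<^sup>2)) + (c - 1 / sqrt pi) * exp (- x\<^sup>2)"
        using elim lagG_eq[OF _ e, of \<tau> a t]
        by (simp add: gauss_def c_def P_def x_def s_def algebra_simps)
      also have "\<bar>\<dots>\<bar> \<le> c * \<bar>P - exp (- x\<^sup>2)\<bar> + \<bar>c - 1 / sqrt pi\<bar> * exp (- x\<^sup>2)"
        using c(1) abs_triangle_ineq[of "c * (P - exp (- x\<^sup>2))" "(c - 1 / sqrt pi) * exp (- x\<^sup>2)"]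
        by (simp add: abs_mult)
      also have "\<dots> \<le> 2 * (28 * exp (1 + (M + 1)\<^sup>2) * s * exp (- M * \<bar>x\<bar>))
          + K * s * exp (1 + M\<^sup>2 - M * \<bar>x\<bar>)"
        unfolding P_def using c s e M K
        by (intro add_mono mult_mono lagProfile_exp_decay gauss_le_exp) auto
      also have "\<dots> = L * s * exp (- M * \<bar>x\<bar>)"
        by (simp add: L_def algebra_simps exp_add exp_diff exp_minus divide_inverse)
      also have "\<dots> \<le> L * s * (exp (M * \<bar>a\<bar>) * exp (- M * \<bar>t\<bar>))"
        unfolding x_def using L s by (intro mult_left_mono exp_minus_abs_diff_le M) auto
      finally show "\<bar>lagG a e \<tau> t - gauss a t\<bar>
          \<le> (L * sqrt 2 * exp (M * \<bar>a\<bar>)) * \<tau> powr (- 1 / 2) * exp (- M * \<bar>t\<bar>)"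
        by (simp add: s_eq mult_ac)
    qed
  qed
  then show ?thesis
    using L by (intro exI[of _ "L * sqrt 2 * exp (M * \<bar>a\<bar>)"]) simp
qed

lemma borel_measurable_lagG [measurable]: "lagG a e \<tau> \<in> borel_measurable borel"
  unfolding lagG_def[abs_def] by measurable

lemma borel_measurable_gauss [measurable]: "gauss a \<in> borel_measurable borel"
  unfolding gauss_def[abs_def] by measurable

text \<open>Since \<open>- M * \<bar>t\<bar> \<le> \<beta> * t\<close>, one two-sided bound yields
  the one-sided bounds for all such \<open>\<beta>\<close> of either sign.\<close>

lemma exp_bounded_decay:
  assumes f: "f \<in> borel_measurable borel" "\<And>t. \<bar>f t\<bar> \<le> B * exp (- M * \<bar>t\<bar>)" and \<beta>: "\<bar>\<beta>\<bar> \<le> M"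
  shows "exp_bounded \<beta> f"
proof -
  have B: "B \<ge> 0" using f(2)[of 0] by simp
  have "- M * \<bar>t\<bar> \<le> \<beta> * t" for t
    using mult_right_mono[OF \<beta>, of "\<bar>t\<bar>"] abs_ge_minus_self[of "\<beta> * t"] by (simp add: abs_mult)
  then have "B * exp (- M * \<bar>t\<bar>) \<le> B * exp (\<beta> * t)" for t
    using B by (intro mult_left_mono) auto
  with f show ?thesis
    unfolding exp_bounded_def by (blast intro: order.trans)
qed

text \<open>This brings the Hermite row into the shape of \<open>lagV_eq\<close>, so that the two
  rows differ only in the innermost function.\<close>

lemma hermU_eq:
  assumes p: "\<And>h. h \<in> {1..r} \<Longrightarrow> d h > 0" "\<And>h. h \<in> {1..r} \<Longrightarrow> \<rho> h > 0" and j: "j \<in> {1..r + 1}"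
  shows "hermU r \<rho> d a j = foldr (\<lambda>l. Kop (\<rho> l) (d l + of_bool (l = j))) [1..<r + 1] (gauss a)"
proof (cases "j = r + 1")
  case True
  then show ?thesis unfolding hermU_def hermF_def by (auto intro!: foldr_cong)
next
  case False
  obtain B where B: "\<And>t. \<bar>gauss a t\<bar> \<le> B * exp (- 0 * \<bar>t\<bar>)"
    using gauss_exp_decay[OF order.refl, of a] by blast
  have "exp_bounded 0 (gauss a)" by (rule exp_bounded_decay[OF _ B]) auto
  then show ?thesis
    using False j p Kop_foldr_raise_shape[of "gauss a" j "[1..<r + 1]" \<rho> d]
    unfolding hermU_def hermF_def by (simp del: upt_Suc)
qed

lemma lagV_approx:
  fixes \<xi> :: real
  assumes p: "\<And>h. h \<in> {1..r} \<Longrightarrow> d h > 0" "\<And>h. h \<in> {1..r} \<Longrightarrow> \<rho> h > 0" and j: "j \<in> {1..r + 1}"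
    and \<xi>: "\<And>h. h \<in> {1..r} \<Longrightarrow> \<xi> + \<rho> h > 0"
  shows "\<exists>C \<delta>. \<delta> > 0 \<and> hermU r \<rho> d a j \<in> borel_measurable borel \<and>
    eventually (\<lambda>\<tau>. lagV r \<rho> d a j \<tau> \<in> borel_measurable borel \<and>
      (\<forall>t. \<bar>lagV r \<rho> d a j \<tau> t - hermU r \<rho> d a j t\<bar>
        \<le> C * \<tau> powr (- 1 / 2) * exp (- \<xi> * t - \<delta> * \<bar>t\<bar>))) at_top"
proof -
  \<comment> \<open>The inserted 1 keeps the minimum meaningful for \<open>r = 0\<close>. Halving
    \<open>m\<close> puts \<open>\<delta>\<close> strictly below every
    \<open>\<xi> + \<rho> h\<close>, which gives
    \<open>- \<xi> + \<delta> < \<rho> h\<close>.\<close>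
  define m where "m = Min (insert 1 ((\<lambda>h. \<xi> + \<rho> h) ` {1..r}))"
  define \<delta> where "\<delta> = m / 2"
  have \<delta>: "\<delta> > 0" "\<And>h. h \<in> {1..r} \<Longrightarrow> \<delta> < \<xi> + \<rho> h"
  proof -
    have "m > 0" using \<xi> unfolding m_def by (subst Min_gr_iff) auto
    moreover have "m \<le> \<xi> + \<rho> h" if "h \<in> {1..r}" for h
      using that unfolding m_def by (intro Min_le) auto
    ultimately show "\<delta> > 0" "\<And>h. h \<in> {1..r} \<Longrightarrow> \<delta> < \<xi> + \<rho> h"
      by (force simp: \<delta>_def)+
  qed
  define M where "M = \<bar>\<xi>\<bar> + \<delta>"
  have M: "M \<ge> 0" using \<delta> by (simp add: M_def)
  define e :: real where "e = of_bool (j = r + 1)"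
  have e: "e = 0 \<or> e = 1" by (simp add: e_def)
  define T where "T f = foldr (\<lambda>l. Kop (\<rho> l) (d l + of_bool (l = j))) [1..<r + 1] f" for f
  have U: "hermU r \<rho> d a j = T (gauss a)" unfolding T_def by (rule hermU_eq[OF p j])
  have V: "lagV r \<rho> d a j \<tau> = T (lagG a e \<tau>)" if "\<tau> > 0" for \<tau>
    unfolding T_def e_def by (rule lagV_eq[OF that p(2)])
  obtain B where B: "\<And>t. \<bar>gauss a t\<bar> \<le> B * exp (- M * \<bar>t\<bar>)" using gauss_exp_decay[OF M] by blast
  obtain C where C: "C \<ge> 0" and ev: "eventually (\<lambda>\<tau>. \<forall>t. \<bar>lagG a e \<tau> t - gauss a t\<bar>
    \<le> C * \<tau> powr (- 1 / 2) * exp (- M * \<bar>t\<bar>)) at_top" using lagG_approx[OF M e] by blast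
  define \<beta> where "\<beta> b = - \<xi> + (if b then \<delta> else - \<delta>)" for b
  \<comment> \<open>The product of eigenvalues from \<open>foldr_Kop_diff_bound\<close>, free of
    \<open>\<tau>\<close>.\<close>
  define Q where "Q b = (\<Prod>l\<leftarrow>[1..<r + 1]. (\<rho> l / (\<rho> l - \<beta> b)) powr (d l + of_bool (l = j)))" for b
  have par: "\<beta> b < \<rho> l \<and> \<rho> l > 0 \<and> d l + of_bool (l = j) > 0" if "l \<in> set [1..<r + 1]" for l b
    using that p[of l] \<delta>(1) \<delta>(2)[of l] by (auto simp: \<beta>_def)
  have \<beta>M: "\<bar>\<beta> b\<bar> \<le> M" for b using \<delta>(1) by (auto simp: \<beta>_def M_def)
  have ebg: "exp_bounded (\<beta> b) (gauss a)" for b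
    using B \<beta>M by (intro exp_bounded_decay) auto
  have meas_U: "hermU r \<rho> d a j \<in> borel_measurable borel"
    unfolding U T_def
    by (rule exp_bounded_measurable[of "\<beta> True"], rule exp_bounded_foldr_Kop[OF ebg par])
  have "eventually (\<lambda>\<tau>::real. \<tau> > 0) at_top" by (rule eventually_gt_at_top)
  with ev have "eventually (\<lambda>\<tau>. lagV r \<rho> d a j \<tau> \<in> borel_measurable borel \<and>
      (\<forall>t. \<bar>lagV r \<rho> d a j \<tau> t - hermU r \<rho> d a j t\<bar>
        \<le> (max (Q True) (Q False) * C) * \<tau> powr (- 1 / 2) * exp (- \<xi> * t - \<delta> * \<bar>t\<bar>))) at_top"
  proof eventually_elim
    case (elim \<tau>)
    define A where "A = C * \<tau> powr (- 1 / 2)"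
    have A: "A \<ge> 0" using C by (simp add: A_def)
    have D: "\<bar>lagG a e \<tau> t - gauss a t\<bar> \<le> A * exp (- M * \<bar>t\<bar>)" for t
      using elim by (simp add: A_def)
    have "\<bar>lagG a e \<tau> t\<bar> \<le> (A + B) * exp (- M * \<bar>t\<bar>)" for t
    proof -
      have "\<bar>lagG a e \<tau> t\<bar> \<le> \<bar>lagG a e \<tau> t - gauss a t\<bar> + \<bar>gauss a t\<bar>" by simp
      then show ?thesis using D[of t] B[of t] by (simp add: distrib_right)
    qed
    then have ebG: "exp_bounded (\<beta> b) (lagG a e \<tau>)" for b
      using \<beta>M by (intro exp_bounded_decay) auto
    have meas_V: "lagV r \<rho> d a j \<tau> \<in> borel_measurable borel"
      unfolding V[OF elim(2)] T_def
      by (rule exp_bounded_measurable[of "\<beta> True"], rule exp_bounded_foldr_Kop[OF ebG par])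
    have bound: "\<bar>lagV r \<rho> d a j \<tau> t - hermU r \<rho> d a j t\<bar> \<le> Q b * A * exp (\<beta> b * t)" for b t
      unfolding V[OF elim(2)] U T_def Q_def
    proof (rule foldr_Kop_diff_bound[OF ebG ebg _ par])
      fix t
      have "- M * \<bar>t\<bar> \<le> \<beta> b * t"
        using mult_right_mono[OF \<beta>M[of b], of "\<bar>t\<bar>"] abs_ge_minus_self[of "\<beta> b * t"]
        by (simp add: abs_mult)
      then have "A * exp (- M * \<bar>t\<bar>) \<le> A * exp (\<beta> b * t)"
        using A by (intro mult_left_mono) auto
      with D[of t] show "\<bar>lagG a e \<tau> t - gauss a t\<bar> \<le> A * exp (\<beta> b * t)" by linarith
    qed
    have "\<bar>lagV r \<rho> d a j \<tau> t - hermU r \<rho> d a j t\<bar>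
        \<le> max (Q True) (Q False) * A * exp (- \<xi> * t - \<delta> * \<bar>t\<bar>)" for t
    proof -
      \<comment> \<open>The sign of \<open>t\<close> selects the sharper of the two exponential
        bounds: \<open>- \<xi> + \<delta>\<close> to the left of 0 and
        \<open>- \<xi> - \<delta>\<close> to the right.\<close>
      define b where "b \<longleftrightarrow> t \<le> 0"
      have "\<beta> b * t = - \<xi> * t - \<delta> * \<bar>t\<bar>" by (auto simp: b_def \<beta>_def algebra_simps)
      then have "\<bar>lagV r \<rho> d a j \<tau> t - hermU r \<rho> d a j t\<bar> \<le> Q b * (A * exp (- \<xi> * t - \<delta> * \<bar>t\<bar>))"
        using bound[of t b] by (simp add: mult.assoc)
      also have "\<dots> \<le> max (Q True) (Q False) * (A * exp (- \<xi> * t - \<delta> * \<bar>t\<bar>))"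
        using A by (intro mult_right_mono) (cases b; auto)+
      finally show ?thesis by (simp add: mult.assoc)
    qed
    with meas_V show ?case by (simp add: A_def mult.assoc)
  qed
  with \<delta>(1) meas_U show ?thesis by blast
qed

section \<open>Locally uniform, weighted L1 and moment convergence\<close>

theorem theorem5p20:
  fixes r q p :: nat and \<rho> d \<xi> :: "nat \<Rightarrow> real" and a :: real
  assumes "q = r + 1" and "p \<ge> 1"
    and "\<And>h. h \<in> {1..r} \<Longrightarrow> d h > 0"
    and "\<And>h. h \<in> {1..r} \<Longrightarrow> \<rho> h > 0"
    and "\<And>i h. i \<in> {1..p} \<Longrightarrow> h \<in> {1..r} \<Longrightarrow> \<xi> i + \<rho> h > 0"
  shows
    "(\<forall>j\<in>{1..q}. \<forall>C. compact C \<longrightarrow>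
        uniform_limit C (\<lambda>\<tau>. lagV r \<rho> d a j \<tau>) (hermU r \<rho> d a j) at_top) \<and>
     (\<forall>i\<in>{1..p}. \<forall>j\<in>{1..q}.
        (\<forall>\<^sub>F \<tau> in at_top.
           integrable lborel (\<lambda>t. exp (\<xi> i * t) * \<bar>lagV r \<rho> d a j \<tau> t - hermU r \<rho> d a j t\<bar>)) \<and>
        ((\<lambda>\<tau>. LBINT t. exp (\<xi> i * t) * \<bar>lagV r \<rho> d a j \<tau> t - hermU r \<rho> d a j t\<bar>)
           \<longlongrightarrow> 0) at_top) \<and>
     (\<forall>v::nat. \<forall>i\<in>{1..p}. \<forall>j\<in>{1..q}.
        (\<forall>\<^sub>F \<tau> in at_top.
           integrable lborel
             (\<lambda>t. t ^ v * exp (\<xi> i * t) * (lagV r \<rho> d a j \<tau> t - hermU r \<rho> d a j t))) \<and>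
        (\<lambda>\<tau>. LBINT t. t ^ v * exp (\<xi> i * t) * (lagV r \<rho> d a j \<tau> t - hermU r \<rho> d a j t))
          \<in> O[at_top](\<lambda>\<tau>. \<tau> powr (- 1 / 2)))"
proof -
  have main: "\<exists>C \<delta>. \<delta> > 0 \<and> hermU r \<rho> d a j \<in> borel_measurable borel \<and>
    eventually (\<lambda>\<tau>. lagV r \<rho> d a j \<tau> \<in> borel_measurable borel \<and>
      (\<forall>t. \<bar>lagV r \<rho> d a j \<tau> t - hermU r \<rho> d a j t\<bar>
        \<le> C * \<tau> powr (- 1 / 2) * exp (- \<xi> i * t - \<delta> * \<bar>t\<bar>))) at_top"
    if "i \<in> {1..p}" "j \<in> {1..q}" for i j
    using that assms by (intro lagV_approx) auto
  have lim: "((\<lambda>\<tau>::real. K * \<tau> powr (- 1 / 2)) \<longlongrightarrow> 0) at_top" for K :: real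
    by real_asymp
  have unif: "uniform_limit D (\<lambda>\<tau>. lagV r \<rho> d a j \<tau>) (hermU r \<rho> d a j) at_top"
    if j: "j \<in> {1..q}" and D: "compact D" for j D
  proof -
    \<comment> \<open>The pointwise bound needs some exponent, and \<open>p \<ge> 1\<close> provides
      \<open>\<xi> 1\<close>; on a compact set its weight is bounded.\<close>
    from assms(2) have "1 \<in> {1..p}" by simp
    from main[OF this j] obtain C \<delta> where
      ev: "eventually (\<lambda>\<tau>. \<forall>t. \<bar>lagV r \<rho> d a j \<tau> t - hermU r \<rho> d a j t\<bar>
        \<le> C * \<tau> powr (- 1 / 2) * exp (- \<xi> 1 * t - \<delta> * \<bar>t\<bar>)) at_top"
      unfolding eventually_conj_iff by blast
    have "compact ((\<lambda>t. exp (- \<xi> 1 * t - \<delta> * \<bar>t\<bar>)) ` D)"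
      by (intro compact_continuous_image continuous_intros D)
    then obtain B where B: "\<And>t. t \<in> D \<Longrightarrow> exp (- \<xi> 1 * t - \<delta> * \<bar>t\<bar>) \<le> B"
      by (fastforce dest!: compact_imp_bounded simp: bounded_iff)
    show ?thesis
    proof (rule uniform_limitI)
      fix \<epsilon> :: real assume "\<epsilon> > 0"
      \<comment> \<open>The bound supplies \<open>C\<close> without a sign, hence the absolute
        value.\<close>
      then have "eventually (\<lambda>\<tau>. \<bar>C\<bar> * B * \<tau> powr (- 1 / 2) < \<epsilon>) at_top"
        by (intro order_tendstoD[OF lim])
      with ev show "eventually (\<lambda>\<tau>. \<forall>t\<in>D. dist (lagV r \<rho> d a j \<tau> t) (hermU r \<rho> d a j t) < \<epsilon>) at_top"
      proof eventually_elim
        case (elim \<tau>)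
        show ?case
        proof
          fix t assume t: "t \<in> D"
          have "\<bar>lagV r \<rho> d a j \<tau> t - hermU r \<rho> d a j t\<bar>
              \<le> C * \<tau> powr (- 1 / 2) * exp (- \<xi> 1 * t - \<delta> * \<bar>t\<bar>)" using elim by blast
          also have "\<dots> \<le> \<bar>C\<bar> * \<tau> powr (- 1 / 2) * B"
            using B[OF t] by (intro mult_mono) auto
          also have "\<dots> < \<epsilon>" using elim by (simp add: mult_ac)
          finally show "dist (lagV r \<rho> d a j \<tau> t) (hermU r \<rho> d a j t) < \<epsilon>"
            by (simp add: dist_real_def)
        qed
      qed
    qed
  qed
  \<comment> \<open>One estimate serves both integral claims: \<open>v = 0\<close> gives the L1
    convergence, general \<open>v\<close> the moments. The weight \<open>exp (\<xi> i * t)\<close>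
    cancels and leaves the integrable
    \<open>\<bar>t\<bar> ^ v * exp (- \<delta> * \<bar>t\<bar>)\<close>.\<close>
  have weighted: "\<exists>K. eventually (\<lambda>\<tau>.
      integrable lborel (\<lambda>t. t ^ v * exp (\<xi> i * t) * (lagV r \<rho> d a j \<tau> t - hermU r \<rho> d a j t)) \<and>
      (LBINT t. \<bar>t ^ v * exp (\<xi> i * t) * (lagV r \<rho> d a j \<tau> t - hermU r \<rho> d a j t)\<bar>)
        \<le> K * \<tau> powr (- 1 / 2)) at_top"
    if i: "i \<in> {1..p}" and j: "j \<in> {1..q}" for i j v
  proof -
    from main[OF i j] obtain C \<delta> where \<delta>: "\<delta> > 0"
      and [measurable]: "hermU r \<rho> d a j \<in> borel_measurable borel"
      and ev: "eventually (\<lambda>\<tau>. lagV r \<rho> d a j \<tau> \<in> borel_measurable borel \<and>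
        (\<forall>t. \<bar>lagV r \<rho> d a j \<tau> t - hermU r \<rho> d a j t\<bar>
        \<le> C * \<tau> powr (- 1 / 2) * exp (- \<xi> i * t - \<delta> * \<bar>t\<bar>))) at_top"
      by blast
    have int: "integrable lborel (\<lambda>t. \<bar>t\<bar> ^ v * exp (- \<delta> * \<bar>t\<bar>))"
      by (rule integrable_power_exp_minus_abs[OF \<delta>])
    define K where "K = C * (LBINT t. \<bar>t\<bar> ^ v * exp (- \<delta> * \<bar>t\<bar>))"
    from ev show ?thesis
    proof (intro exI[of _ K], eventually_elim)
      case (elim \<tau>)
      then have [measurable]: "lagV r \<rho> d a j \<tau> \<in> borel_measurable borel" by blast
      define f where "f t = t ^ v * exp (\<xi> i * t) * (lagV r \<rho> d a j \<tau> t - hermU r \<rho> d a j t)" for t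
      have [measurable]: "f \<in> borel_measurable borel" unfolding f_def[abs_def] by measurable
      have f: "\<bar>f t\<bar> \<le> C * \<tau> powr (- 1 / 2) * (\<bar>t\<bar> ^ v * exp (- \<delta> * \<bar>t\<bar>))" for t
      proof -
        have "\<bar>f t\<bar> \<le> \<bar>t\<bar> ^ v * exp (\<xi> i * t)
            * (C * \<tau> powr (- 1 / 2) * exp (- \<xi> i * t - \<delta> * \<bar>t\<bar>))"
          using elim unfolding f_def abs_mult power_abs
          by (intro mult_mono) auto
        also have "\<dots> = C * \<tau> powr (- 1 / 2)
            * (\<bar>t\<bar> ^ v * (exp (\<xi> i * t) * exp (- \<xi> i * t - \<delta> * \<bar>t\<bar>)))"
          by (simp only: mult_ac)
        also have "exp (\<xi> i * t) * exp (- \<xi> i * t - \<delta> * \<bar>t\<bar>) = exp (- \<delta> * \<bar>t\<bar>)"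
          by (simp add: exp_add[symmetric])
        finally show ?thesis .
      qed
      have bound: "integrable lborel (\<lambda>t. C * \<tau> powr (- 1 / 2) * (\<bar>t\<bar> ^ v * exp (- \<delta> * \<bar>t\<bar>)))"
        by (intro integrable_mult_right int)
      have fi: "integrable lborel f"
        by (rule Bochner_Integration.integrable_bound[OF bound])
          (auto intro!: AE_I2 order.trans[OF f])
      have "(LBINT t. \<bar>f t\<bar>) \<le> (LBINT t. C * \<tau> powr (- 1 / 2) * (\<bar>t\<bar> ^ v * exp (- \<delta> * \<bar>t\<bar>)))"
        by (intro integral_mono integrable_abs[OF fi] bound f)
      also have "\<dots> = K * \<tau> powr (- 1 / 2)" by (simp add: K_def)
      finally show ?case using fi unfolding f_def[abs_def] by blast
    qed
  qed
  have L1: "(\<forall>\<^sub>F \<tau> in at_top.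
           integrable lborel (\<lambda>t. exp (\<xi> i * t) * \<bar>lagV r \<rho> d a j \<tau> t - hermU r \<rho> d a j t\<bar>)) \<and>
        ((\<lambda>\<tau>. LBINT t. exp (\<xi> i * t) * \<bar>lagV r \<rho> d a j \<tau> t - hermU r \<rho> d a j t\<bar>)
           \<longlongrightarrow> 0) at_top" if ij: "i \<in> {1..p}" "j \<in> {1..q}" for i j
  proof -
    obtain K where ev: "eventually (\<lambda>\<tau>.
      integrable lborel (\<lambda>t. exp (\<xi> i * t) * (lagV r \<rho> d a j \<tau> t - hermU r \<rho> d a j t)) \<and>
      (LBINT t. \<bar>exp (\<xi> i * t) * (lagV r \<rho> d a j \<tau> t - hermU r \<rho> d a j t)\<bar>)
        \<le> K * \<tau> powr (- 1 / 2)) at_top"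
      using weighted[OF ij, of 0] by auto
    show ?thesis
    proof
      from ev show "\<forall>\<^sub>F \<tau> in at_top.
           integrable lborel (\<lambda>t. exp (\<xi> i * t) * \<bar>lagV r \<rho> d a j \<tau> t - hermU r \<rho> d a j t\<bar>)"
      proof eventually_elim
        case (elim \<tau>)
        from elim[THEN conjunct1, THEN integrable_abs] show ?case by (simp add: abs_mult)
      qed
      show "((\<lambda>\<tau>. LBINT t. exp (\<xi> i * t) * \<bar>lagV r \<rho> d a j \<tau> t - hermU r \<rho> d a j t\<bar>)
           \<longlongrightarrow> 0) at_top"
      proof (rule tendsto_sandwich[OF _ _ tendsto_const lim[of K]])
        show "\<forall>\<^sub>F \<tau> in at_top. 0 \<le> (LBINT t. exp (\<xi> i * t) * \<bar>lagV r \<rho> d a j \<tau> t - hermU r \<rho> d a j t\<bar>)"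
          by (intro always_eventually allI Bochner_Integration.integral_nonneg) auto
        from ev show "\<forall>\<^sub>F \<tau> in at_top.
            (LBINT t. exp (\<xi> i * t) * \<bar>lagV r \<rho> d a j \<tau> t - hermU r \<rho> d a j t\<bar>) \<le> K * \<tau> powr (- 1 / 2)"
          by eventually_elim (simp add: abs_mult)
      qed
    qed
  qed
  have moment: "(\<forall>\<^sub>F \<tau> in at_top.
           integrable lborel
             (\<lambda>t. t ^ v * exp (\<xi> i * t) * (lagV r \<rho> d a j \<tau> t - hermU r \<rho> d a j t))) \<and>
        (\<lambda>\<tau>. LBINT t. t ^ v * exp (\<xi> i * t) * (lagV r \<rho> d a j \<tau> t - hermU r \<rho> d a j t))
          \<in> O[at_top](\<lambda>\<tau>. \<tau> powr (- 1 / 2))" if ij: "i \<in> {1..p}" "j \<in> {1..q}" for v i j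
  proof -
    let ?f = "\<lambda>\<tau> t. t ^ v * exp (\<xi> i * t) * (lagV r \<rho> d a j \<tau> t - hermU r \<rho> d a j t)"
    obtain K where ev: "eventually (\<lambda>\<tau>. integrable lborel (?f \<tau>) \<and>
        (LBINT t. \<bar>?f \<tau> t\<bar>) \<le> K * \<tau> powr (- 1 / 2)) at_top"
      using weighted[OF ij, of v] by blast
    from ev have "eventually (\<lambda>\<tau>. norm (LBINT t. ?f \<tau> t) \<le> K * norm (\<tau> powr (- 1 / 2))) at_top"
    proof eventually_elim
      case (elim \<tau>)
      have "norm (LBINT t. ?f \<tau> t) \<le> (LBINT t. norm (?f \<tau> t))" by (rule integral_norm_bound)
      also have "\<dots> \<le> K * norm (\<tau> powr (- 1 / 2))"
        using elim[THEN conjunct2] by (simp only: real_norm_def abs_of_nonneg[OF powr_ge_zero])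
      finally show ?case .
    qed
    then have "(\<lambda>\<tau>. LBINT t. ?f \<tau> t) \<in> O[at_top](\<lambda>\<tau>. \<tau> powr (- 1 / 2))" by (rule bigoI)
    moreover from ev have "\<forall>\<^sub>F \<tau> in at_top. integrable lborel (?f \<tau>)"
      by eventually_elim blast
    ultimately show ?thesis by blast
  qed
  show ?thesis using unif L1 moment by blast
qed

end
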